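(* Let $n\ge1$. For each $\frac n2\le\alpha<n+1$ and all sufficiently large $R$, there exist a nonzero $f\in L^2(\mathbb{R}^n)$ with $\widehat f$ supported in $B_1^n(0)$ and a union of unit cubes $Y\subset B_R^{n+1}(0)$ such that $\gamma_{\alpha,R^{1/2}}(Y)\sim1$ and $\overline{\gamma_{\alpha,R}}(Y)=\gamma_{\alpha,R}(Y)\sim R^{\frac{n+1-\alpha}{2}}$, for which $$\|e^{it\Delta}f\|_{L^2(Y)}\gtrapprox\Big(\gamma_{\alpha,R^{1/2}}(Y)\,\overline{\gamma_{\alpha,R}}(Y)\,R^\alpha\,\sup_{B_{R^{1/2}}}|Y\cap B_{R^{1/2}}|^{n}\Big)^{\frac{1}{(n+1)(n+2)}}\|f\|_{L^2}.$$
   Context: $A\gtrapprox B$ means that for every $\epsilon>0$, $B\le C_\epsilon R^\epsilon A$ with $C_\epsilon$ independent of $R$. $A\sim B$ means $C^{-1}B\le A\le CB$ with $C$ independent of $R$. $B_\rho^k(c)$ is the cube in $\mathbb{R}^k$ of side length $\rho$ centered at $c$; $B_\rho$ denotes a cube of side length $\rho$ in $\mathbb{R}^{n+1}$; $|\cdot|$ is Lebesgue measure. For $f\in L^2(\mathbb{R}^n)$, $e^{it\Delta}f(x)=(2\pi)^{-n}\int_{\mathbb{R}^n}e^{ix\cdot\xi}e^{it|\xi|^2}\widehat{f}(\xi)\,d\xi$, regarded as a function of $(x,t)\in\mathbb{R}^{n+1}$. For $Y\subset\mathbb{R}^{n+1}$ and $s\ge 1$, $\gamma_{\alpha,s}(Y)=\sup_{1\le\rho\le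 s}\sup_{B_\rho}\rho^{-\alpha}|Y\cap B_\rho|$ and $\overline{\gamma_{\alpha,R}}(Y)=\sup_{R^{1/2}\le\rho\le R}\sup_{B_\rho}\rho^{-\alpha}|Y\cap B_\rho|$, the inner suprema being over all cubes $B_\rho\subset\mathbb{R}^{n+1}$ of side length $\rho$. *)

theory Defs
  imports "HOL-Analysis.Analysis"
begin

text \<open>
  The space-time \<open>\<real>\<^sup>n\<^sup>+\<^sup>1\<close> is the product \<open>(real^'n) \<times> real\<close> with \<open>n = CARD('n)\<close>. All integrals
  are with respect to \<open>lebesgue\<close>, the completed measure, because an arbitrary union of closed
  cubes need not be a Borel set, although it is always Lebesgue measurable.
\<close>

definition cube :: "real \<Rightarrow> 'a::euclidean_space \<Rightarrow> 'a set" where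
  "cube \<rho> c = cbox (c - (\<rho> / 2) *\<^sub>R One) (c + (\<rho> / 2) *\<^sub>R One)"

definition square_integrable :: "('a::euclidean_space \<Rightarrow> complex) \<Rightarrow> bool" where
  "square_integrable f \<longleftrightarrow>
     f \<in> borel_measurable lebesgue \<and> integrable lebesgue (\<lambda>x. (cmod (f x))\<^sup>2)"

definition L2_norm_on :: "'a::euclidean_space set \<Rightarrow> ('a \<Rightarrow> complex) \<Rightarrow> real" where
  "L2_norm_on S f = sqrt (LINT x:S|lebesgue. (cmod (f x))\<^sup>2)"

definition fourier_integral :: "('a::euclidean_space \<Rightarrow> complex) \<Rightarrow> 'a \<Rightarrow> complex" where
  "fourier_integral f \<xi> = (LINT x|lebesgue. exp (- \<i> * complex_of_real (x \<bullet> \<xi>)) * f x)"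

text \<open>
  The Fourier transform on \<open>L\<^sup>2\<close> as the continuous extension of the Fourier integral from
  \<open>L\<^sup>1 \<inter> L\<^sup>2\<close>: \<open>g\<close> represents the transform of \<open>f\<close>. By Plancherel's theorem such a \<open>g\<close> exists for
  every square integrable \<open>f\<close> and is unique up to a null set. Square integrability of
  \<open>fourier_integral (F k)\<close> is automatic, also by Plancherel; it is listed because \<open>L2_norm_on\<close>
  is meaningful only for square integrable arguments.
\<close>

definition has_fourier_transform ::
    "('a::euclidean_space \<Rightarrow> complex) \<Rightarrow> ('a \<Rightarrow> complex) \<Rightarrow> bool" where
  "has_fourier_transform f g \<longleftrightarrow>
     square_integrable f \<and> square_integrable g \<and>
     (\<exists>F :: nat \<Rightarrow> 'a \<Rightarrow> complex.
        (\<forall>k. integrable lebesgue (F k) \<and> square_integrable (F k) \<and>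
             square_integrable (fourier_integral (F k))) \<and>
        (\<lambda>k. L2_norm_on UNIV (\<lambda>x. F k x - f x)) \<longlonglongrightarrow> 0 \<and>
        (\<lambda>k. L2_norm_on UNIV (\<lambda>\<xi>. fourier_integral (F k) \<xi> - g \<xi>)) \<longlonglongrightarrow> 0)"

text \<open>
  \<open>schroedinger g (x, t)\<close> is \<open>e\<^sup>i\<^sup>t\<^sup>\<Delta>f(x)\<close> where \<open>g\<close> is the Fourier transform of \<open>f\<close>; the value does
  not depend on the choice of the representative \<open>g\<close>.
\<close>

definition schroedinger :: "(real ^ 'n \<Rightarrow> complex) \<Rightarrow> (real ^ 'n) \<times> real \<Rightarrow> complex" where
  "schroedinger g = (\<lambda>(x, t).
     complex_of_real (1 / (2 * pi) ^ CARD('n)) *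
     (LINT \<xi>|lebesgue. exp (\<i> * complex_of_real (x \<bullet> \<xi>)) *
        exp (\<i> * complex_of_real (t * (norm \<xi>)\<^sup>2)) * g \<xi>))"

text \<open>
  The suprema below are over nonempty sets of reals when \<open>1 \<le> s\<close> (respectively \<open>1 \<le> R\<close>), and they
  are bounded, since the measure of \<open>Y \<inter> cube \<rho> c\<close> is at most that of the cube.
\<close>

definition gamma_sup :: "real \<Rightarrow> real \<Rightarrow> 'a::euclidean_space set \<Rightarrow> real" where
  "gamma_sup \<alpha> s Y =
     (SUP \<rho>\<in>{1..s}. SUP c. \<rho> powr (- \<alpha>) * measure lebesgue (Y \<inter> cube \<rho> c))"

definition gamma_bar :: "real \<Rightarrow> real \<Rightarrow> 'a::euclidean_space set \<Rightarrow> real" where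
  "gamma_bar \<alpha> R Y =
     (SUP \<rho>\<in>{sqrt R..R}. SUP c. \<rho> powr (- \<alpha>) * measure lebesgue (Y \<inter> cube \<rho> c))"

text \<open>
  \<open>A \<sim> B\<close> and \<open>A \<greaterapprox> B\<close> for quantities depending on \<open>R\<close>, with constants uniform in \<open>R \<ge> R0\<close>.
\<close>

definition sim_from :: "real \<Rightarrow> (real \<Rightarrow> real) \<Rightarrow> (real \<Rightarrow> real) \<Rightarrow> bool" where
  "sim_from R0 A B \<longleftrightarrow> (\<exists>C>0. \<forall>R\<ge>R0. inverse C * B R \<le> A R \<and> A R \<le> C * B R)"

definition gtrapprox_from :: "real \<Rightarrow> (real \<Rightarrow> real) \<Rightarrow> (real \<Rightarrow> real) \<Rightarrow> bool" where
  "gtrapprox_from R0 A B \<longleftrightarrow> (\<forall>\<epsilon>>0. \<exists>C>0. \<forall>R\<ge>R0. B R \<le> C * R powr \<epsilon> * A R)"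

end

theory Submission
  imports Defs "HOL-Probability.Sinc_Integral" "HOL-Real_Asymp.Real_Asymp"
begin

text \<open>
  The data focus periodically in space and time (a Talbot effect). Put
  \<open>l = R powr (- (n + 1 - \<alpha>) / (2 * (n + 2)))\<close> and \<open>d = 1 / (4 * R)\<close>. The transform of \<open>f\<close> is a tensor
  product of combs: tents of width \<open>d\<close> around the points of \<open>l\<int> \<inter> [-1/4, 1/4]\<close> in each coordinate.
  At frequency \<open>l * m\<close>, \<open>x = 2\<pi>k/l\<close> and \<open>t = 2\<pi>j/l\<^sup>2\<close>, the phase \<open>x\<xi> + t\<xi>\<^sup>2\<close> is a multiple of
  \<open>2\<pi>\<close>, and it stays within \<open>1\<close> of it on the tent and on the unit cube around \<open>(x, t)\<close>. So there is no
  cancellation on the union \<open>Y\<close> of these cubes, and \<open>|e\<^sup>i\<^sup>t\<^sup>\<Delta>f|\<close> is comparable to the integral of the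
  transform there. The value of \<open>l\<close> is chosen so that \<open>|Y| \<sim> R powr ((n + 1 + \<alpha>) / 2)\<close>, and \<open>\<alpha> \<ge> n / 2\<close> makes the
  time period \<open>2\<pi>/l\<^sup>2\<close> at most a multiple of \<open>sqrt R\<close>. A cube of side \<open>\<rho>\<close> contains at most about
  \<open>(1 + \<rho>l)\<^sup>n(1 + \<rho>l\<^sup>2)\<close> of the unit cubes, which gives the density estimates. Both sides of the
  inequality are then comparable without a loss of \<open>R powr \<epsilon>\<close>.

  The inverse transform of a tent is the Fejer kernel, so \<open>f\<close> is the kernel times a trigonometric
  polynomial in each coordinate; its \<open>L\<^sup>2\<close> norm is bounded by using the kernel as a weight with
  respect to which the characters are orthonormal.
\<close>

section \<open>Integrals of tensor products, and a cosine integral\<close>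

lemma
  fixes g :: "'a::euclidean_space \<Rightarrow> real \<Rightarrow> 'b::{real_normed_field,banach,second_countable_topology}"
  assumes int: "\<And>b. b \<in> Basis \<Longrightarrow> integrable lborel (g b)"
  shows integrable_lborel_prod_Basis: "integrable lborel (\<lambda>x. \<Prod>b\<in>Basis. g b (x \<bullet> b))"
    and integral_lborel_prod_Basis:
      "(LINT x|lborel. (\<Prod>b\<in>Basis. g b (x \<bullet> b))) = (\<Prod>b\<in>Basis. integral\<^sup>L lborel (g b))"
proof -
  interpret product_sigma_finite "\<lambda>b::'a. lborel :: real measure"
    by standard
  let ?T = "\<lambda>f::'a \<Rightarrow> real. \<Sum>b\<in>Basis. f b *\<^sub>R b"
  have T: "?T \<in> measurable (\<Pi>\<^sub>M b\<in>(Basis::'a set). lborel) borel"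
    by measurable
  have meas: "(\<lambda>x. \<Prod>b\<in>Basis. g b (x \<bullet> b)) \<in> borel_measurable (borel :: 'a measure)"
    using int by (intro borel_measurable_prod) (auto dest!: borel_measurable_integrable)
  have eq: "(\<Prod>b\<in>Basis. g b (?T f \<bullet> b)) = (\<Prod>b\<in>Basis. g b (f b))" for f
    by (intro prod.cong) auto
  \<comment> \<open>\<open>lborel_eq\<close> presents \<open>lborel\<close> as the image under
    \<open>?T\<close> of the product of one-dimensional Lebesgue measures, which reduces both claims
    to Fubini on the finite product.\<close>
  show "integrable lborel (\<lambda>x. \<Prod>b\<in>Basis. g b (x \<bullet> b))"
    by (subst lborel_eq, subst integrable_distr_eq[OF T meas], subst eq)
       (intro product_integrable_prod int finite_Basis)
  show "(LINT x|lborel. (\<Prod>b\<in>Basis. g b (x \<bullet> b))) = (\<Prod>b\<in>Basis. integral\<^sup>L lborel (g b))"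
    by (subst lborel_eq, subst integral_distr[OF T meas], subst eq)
       (intro product_integral_prod int finite_Basis)
qed

lemma has_bochner_integral_reflect:
  fixes f :: "real \<Rightarrow> 'a::{banach, second_countable_topology}"
  assumes "has_bochner_integral lborel f I"
  shows "has_bochner_integral lborel (\<lambda>x. f (- x)) I"
  using lborel_has_bochner_integral_real_affine_iff[of "-1" f I 0] assms by simp

text \<open>Integration by parts against \<open>- 1 / y\<close> leaves a sine integral, whence the
  antiderivative \<open>?F\<close>. It tends to 0 at 0 and, by \<open>Si_at_top\<close>, to
  \<open>pi * a / 2\<close> at infinity; as the integrand is nonnegative, the fundamental theorem
  yields integrability along with the value.\<close>

lemma has_bochner_integral_one_minus_cos_pos:
  fixes a :: real
  assumes "0 < a"
  shows "has_bochner_integral lborel (\<lambda>y. indicator {0<..} y * ((1 - cos (a * y)) / y\<^sup>2)) (pi * a / 2)"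
proof -
  let ?f = "\<lambda>y::real. (1 - cos (a * y)) / y\<^sup>2"
  let ?F = "\<lambda>y. a * Si (a * y) - (1 - cos (a * y)) / y"
  have deriv: "DERIV ?F y :> ?f y" if "0 < y" for y
  proof -
    have Si: "DERIV (\<lambda>y. Si (a * y)) y :> sinc (a * y) * a"
      using DERIV_chain2[OF DERIV_Si, of "\<lambda>y. a * y" a y UNIV]
      by (auto intro!: derivative_eq_intros)
    have "DERIV ?F y :> a * (sinc (a * y) * a) - (sin (a * y) * a * y - (1 - cos (a * y))) / (y * y)"
      using that by (auto intro!: derivative_eq_intros Si)
    moreover have "a * (sinc (a * y) * a) - (sin (a * y) * a * y - (1 - cos (a * y))) / (y * y) = ?f y"
      using that \<open>0 < a\<close> by (simp add: field_simps power2_eq_square)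
    ultimately show ?thesis by simp
  qed
  have at_0: "(?F \<longlongrightarrow> 0) (at_right 0)"
  proof -
    have "isCont (\<lambda>y. Si (a * y)) 0"
      by (intro isCont_o2[OF _ isCont_Si] continuous_intros)
    then have 1: "((\<lambda>y. Si (a * y)) \<longlongrightarrow> Si 0) (at_right 0)"
      unfolding isCont_def by (auto intro: tendsto_within_subset)
    have "Si 0 = 0" by (simp add: Si_def zero_ereal_def)
    have 2: "((\<lambda>y::real. (1 - cos (a * y)) / y) \<longlongrightarrow> 0) (at_right 0)"
      using \<open>0 < a\<close> by real_asymp
    show ?thesis
      using tendsto_diff[OF tendsto_mult[OF tendsto_const[of a] 1] 2] \<open>Si 0 = 0\<close> by simp
  qed
  have at_top: "(?F \<longlongrightarrow> pi * a / 2) at_top"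
  proof -
    have "filterlim (\<lambda>y. a * y) at_top at_top"
      using \<open>0 < a\<close> by real_asymp
    then have 1: "((\<lambda>y. Si (a * y)) \<longlongrightarrow> pi / 2) at_top"
      by (rule filterlim_compose[OF Si_at_top])
    have 2: "((\<lambda>y::real. (1 - cos (a * y)) / y) \<longlongrightarrow> 0) at_top"
      using \<open>0 < a\<close> by real_asymp
    show ?thesis
      using tendsto_diff[OF tendsto_mult[OF tendsto_const[of a] 1] 2] by (simp add: mult_ac)
  qed
  have lim_0: "((?F \<circ> real_of_ereal) \<longlongrightarrow> 0) (at_right 0)"
    using at_0 by (simp add: ereal_tendsto_simps zero_ereal_def)
  have lim_top: "((?F \<circ> real_of_ereal) \<longlongrightarrow> pi * a / 2) (at_left \<infinity>)"
    using at_top by (simp add: ereal_tendsto_simps)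
  have F: "DERIV ?F y :> ?f y" and cont: "isCont ?f y" if "0 < ereal y" "ereal y < \<infinity>" for y
    using that by (auto intro!: deriv continuous_intros)
  have "set_integrable lborel (einterval 0 \<infinity>) ?f" "(LBINT y=0..\<infinity>. ?f y) = pi * a / 2 - 0"
    using interval_integral_FTC_nonneg[OF _ F cont _ lim_0 lim_top] by auto
  then show ?thesis
    unfolding interval_lebesgue_integral_0_infty
    by (simp add: has_bochner_integral_iff set_integrable_def set_lebesgue_integral_def einterval_eq
        zero_ereal_def)
qed

lemma has_bochner_integral_one_minus_cos:
  "has_bochner_integral lborel (\<lambda>y. (1 - cos (a * y)) / y\<^sup>2) (pi * \<bar>a\<bar>)"
proof -
  let ?f = "\<lambda>y::real. (1 - cos (\<bar>a\<bar> * y)) / y\<^sup>2"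
  let ?g = "\<lambda>y. indicator {0<..} y * ?f y"
  have cos_abs: "cos (a * y) = cos (\<bar>a\<bar> * y)" for y
    by (cases "a \<ge> 0") auto
  show ?thesis
  proof (cases "a = 0")
    case True
    then show ?thesis
      by (simp add: has_bochner_integral_zero)
  next
    case False
    then have g: "has_bochner_integral lborel ?g (pi * \<bar>a\<bar> / 2)"
      by (intro has_bochner_integral_one_minus_cos_pos) auto
    have "has_bochner_integral lborel (\<lambda>y. ?g y + ?g (- y)) (pi * \<bar>a\<bar> / 2 + pi * \<bar>a\<bar> / 2)"
      by (intro has_bochner_integral_add has_bochner_integral_reflect[OF g] g)
    \<comment> \<open>At \<open>y = 0\<close> both indicators vanish, and so does \<open>?f\<close>,
      because division by 0 gives 0.\<close>
    moreover have "?g y + ?g (- y) = ?f y" for y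
      by (auto simp: indicator_def)
    ultimately show ?thesis
      by (simp add: cos_abs)
  qed
qed

subsection \<open>Fejer kernels and tents\<close>

text \<open>With \<open>u = d * y / 2\<close> this is \<open>d / (2 * pi) * (sin u / u)^2\<close>,
  the Fejer kernel normalised to integral 1. The value at \<open>y = 0\<close> is 0 by the division
  convention, which changes it on a null set only.\<close>

definition fejer :: "real \<Rightarrow> real \<Rightarrow> real" where
  "fejer d y = (1 - cos (d * y)) / (pi * d * y\<^sup>2)"

definition tent :: "real \<Rightarrow> real \<Rightarrow> real" where
  "tent d s = max 0 (1 - \<bar>s\<bar> / d)"

text \<open>Product-to-sum formulas write the integrand as a combination of functions
  \<open>(1 - cos (a * y)) / y^2\<close> with \<open>a = d + s\<close>, \<open>d - s\<close> and
  \<open>s\<close>. Their integrals are multiples of \<open>\<bar>a\<bar>\<close>, and the resulting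
  second difference of the absolute value is the tent.\<close>

lemma has_bochner_integral_cos_fejer:
  assumes "0 < d"
  shows "has_bochner_integral lborel (\<lambda>y. cos (y * s) * fejer d y) (tent d s)"
proof -
  let ?q = "\<lambda>a y::real. (1 - cos (a * y)) / y\<^sup>2"
  have "has_bochner_integral lborel
      (\<lambda>y. (1 / (pi * d)) * ((1/2) * ?q (d + s) y + (1/2) * ?q (d - s) y - ?q s y))
      ((1 / (pi * d)) * ((1/2) * (pi * \<bar>d + s\<bar>) + (1/2) * (pi * \<bar>d - s\<bar>) - pi * \<bar>s\<bar>))"
    by (intro has_bochner_integral_mult_right has_bochner_integral_add has_bochner_integral_diff
        has_bochner_integral_one_minus_cos)
  moreover have "(1 / (pi * d)) * ((1/2) * ?q (d + s) y + (1/2) * ?q (d - s) y - ?q s y)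
      = cos (y * s) * fejer d y" for y
  proof (cases "y = 0")
    case False
    have "cos ((d + s) * y) + cos ((d - s) * y) = 2 * (cos (d * y) * cos (y * s))"
      using cos_add[of "d * y" "s * y"] cos_diff[of "d * y" "s * y"]
      by (simp only: distrib_right left_diff_distrib mult.commute[of y s])
    then have "(1/2) * (1 - cos ((d + s) * y)) + (1/2) * (1 - cos ((d - s) * y)) - (1 - cos (s * y))
        = cos (y * s) * (1 - cos (d * y))"
      by (simp add: algebra_simps)
    then have "((1/2) * (1 - cos ((d + s) * y)) + (1/2) * (1 - cos ((d - s) * y)) - (1 - cos (s * y))) / (pi * d * y\<^sup>2)
        = cos (y * s) * (1 - cos (d * y)) / (pi * d * y\<^sup>2)"
      by simp
    then show ?thesis
      by (simp add: fejer_def add_divide_distrib diff_divide_distrib algebra_simps)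
  qed (simp add: fejer_def)
  moreover have "(1 / (pi * d)) * ((1/2) * (pi * \<bar>d + s\<bar>) + (1/2) * (pi * \<bar>d - s\<bar>) - pi * \<bar>s\<bar>) = tent d s"
    using assms by (auto simp: tent_def max_def abs_if field_simps)
  ultimately show ?thesis by simp
qed

lemma has_bochner_integral_fejer: "0 < d \<Longrightarrow> has_bochner_integral lborel (fejer d) 1"
  using has_bochner_integral_cos_fejer[of d 0] by (simp add: tent_def)

lemma integrable_fejer: "0 < d \<Longrightarrow> integrable lborel (fejer d)"
  using has_bochner_integral_fejer by (simp add: has_bochner_integral_iff)

lemma fejer_measurable [measurable]: "fejer d \<in> borel_measurable borel"
  unfolding fejer_def by measurable

lemma tent_measurable [measurable]: "tent d \<in> borel_measurable borel"
  unfolding tent_def by measurable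

lemma fejer_nonneg: "0 < d \<Longrightarrow> 0 \<le> fejer d y"
  by (simp add: fejer_def)

lemma fejer_le:
  assumes "0 < d"
  shows "fejer d y \<le> d / (2 * pi)"
proof (cases "y = 0")
  case False
  have "1 - cos (d * y) = 2 * (sin (d * y / 2))\<^sup>2"
    using cos_double_sin[of "d * y / 2"] by simp
  also have "\<dots> \<le> 2 * (d * y / 2)\<^sup>2"
    using abs_sin_x_le_abs_x[of "d * y / 2"] by (simp only: abs_le_square_iff)
  finally have "1 - cos (d * y) \<le> d\<^sup>2 * y\<^sup>2 / 2"
    by (simp add: power_mult_distrib power_divide)
  then have "fejer d y \<le> (d\<^sup>2 * y\<^sup>2 / 2) / (pi * d * y\<^sup>2)"
    unfolding fejer_def using assms by (intro divide_right_mono) auto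
  also have "\<dots> = d / (2 * pi)"
    using False assms by (simp add: field_simps power2_eq_square)
  finally show ?thesis .
qed (use assms in \<open>simp add: fejer_def\<close>)

lemma has_bochner_integral_cis_fejer:
  assumes "0 < d"
  shows "has_bochner_integral lborel (\<lambda>y. cis (- (y * s)) * complex_of_real (fejer d y)) (tent d s)"
proof -
  have int: "integrable lborel (\<lambda>y. sin (y * s) * fejer d y)"
    using fejer_nonneg[OF assms]
    by (intro Bochner_Integration.integrable_bound[OF integrable_fejer[OF assms]])
       (auto simp: abs_mult intro!: mult_left_le_one_le)
  \<comment> \<open>The sine part is odd: reflection shows that its integral equals its own
    negative, so only the cosine part survives.\<close>
  have "has_bochner_integral lborel (\<lambda>y. sin (- y * s) * fejer d (- y)) (LINT y|lborel. sin (y * s) * fejer d y)"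
    by (rule has_bochner_integral_reflect[where f = "\<lambda>y. sin (y * s) * fejer d y"])
       (use int in \<open>simp add: has_bochner_integral_iff\<close>)
  then have "(LINT y|lborel. sin (y * s) * fejer d y) = (LINT y|lborel. - (sin (y * s) * fejer d y))"
    by (simp add: has_bochner_integral_iff fejer_def)
  then have sin0: "has_bochner_integral lborel (\<lambda>y. sin (y * s) * fejer d y) 0"
    using int by (simp add: has_bochner_integral_iff)
  have "has_bochner_integral lborel
      (\<lambda>y. complex_of_real (cos (y * s) * fejer d y) - \<i> * complex_of_real (sin (y * s) * fejer d y))
      (complex_of_real (tent d s) - \<i> * complex_of_real 0)"
    by (intro has_bochner_integral_diff has_bochner_integral_mult_right has_bochner_integral_of_real
        has_bochner_integral_cos_fejer assms sin0)
  moreover have "complex_of_real (cos (y * s) * fejer d y) - \<i> * complex_of_real (sin (y * s) * fejer d y)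
      = cis (- (y * s)) * complex_of_real (fejer d y)" for y
    by (simp add: complex_eq_iff)
  ultimately show ?thesis by simp
qed

section \<open>One-dimensional combs and their L2 bounds\<close>

definition comb_hat :: "real \<Rightarrow> real \<Rightarrow> int set \<Rightarrow> real \<Rightarrow> real" where
  "comb_hat d l M s = (\<Sum>m\<in>M. tent d (s - l * of_int m))"

definition comb_fun :: "real \<Rightarrow> real \<Rightarrow> int set \<Rightarrow> real \<Rightarrow> complex" where
  "comb_fun d l M y = complex_of_real (fejer d y) * (\<Sum>m\<in>M. cis (l * of_int m * y))"

lemma comb_fun_measurable [measurable]: "comb_fun d l M \<in> borel_measurable borel"
  unfolding comb_fun_def cis_conv_exp by measurable

lemma comb_hat_measurable [measurable]: "comb_hat d l M \<in> borel_measurable borel"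
  unfolding comb_hat_def by measurable

lemma comb_hat_nonneg: "0 \<le> comb_hat d l M s"
  unfolding comb_hat_def tent_def by (intro sum_nonneg) auto

text \<open>Multiplying the kernel by \<open>cis (l * m * y)\<close> translates its transform, a
  tent, to the centre \<open>l * m\<close>.\<close>

lemma has_bochner_integral_comb_fun:
  assumes "0 < d"
  shows "has_bochner_integral lborel (\<lambda>y. cis (- (y * s)) * comb_fun d l M y) (comb_hat d l M s)"
proof -
  have "has_bochner_integral lborel
      (\<lambda>y. \<Sum>m\<in>M. cis (- (y * (s - l * of_int m))) * complex_of_real (fejer d y)) 
      (\<Sum>m\<in>M. complex_of_real (tent d (s - l * of_int m)))"
    by (intro has_bochner_integral_sum has_bochner_integral_cis_fejer assms)
  moreover have "(\<Sum>m\<in>M. cis (- (y * (s - l * of_int m))) * complex_of_real (fejer d y))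
      = cis (- (y * s)) * comb_fun d l M y" for y
    by (simp add: comb_fun_def sum_distrib_left cis_mult algebra_simps)
  ultimately show ?thesis
    by (simp add: comb_hat_def)
qed

lemma integrable_comb_fun:
  assumes "0 < d"
  shows "integrable lborel (comb_fun d l M)"
  using has_bochner_integral_comb_fun[OF assms, of 0 l M] by (simp add: has_bochner_integral_iff)

lemma tent_eq_0: "0 < d \<Longrightarrow> d \<le> \<bar>s\<bar> \<Longrightarrow> tent d s = 0"
  by (simp add: tent_def)

text \<open>Since \<open>d \<le> l\<close>, the characters are orthonormal with respect to the weight \<open>fejer d\<close>.\<close>

lemma has_bochner_integral_fejer_trig_poly:
  assumes "0 < d" "d \<le> l" "finite M"
  shows "has_bochner_integral lborel
    (\<lambda>y. fejer d y * (cmod (\<Sum>m\<in>M. cis (l * of_int m * y)))\<^sup>2) (card M)"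
proof -
  have "has_bochner_integral lborel
      (\<lambda>y. \<Sum>m\<in>M. \<Sum>k\<in>M. cos (y * (l * of_int (m - k))) * fejer d y)
      (\<Sum>m\<in>M. \<Sum>k\<in>M. tent d (l * of_int (m - k)))"
    by (intro has_bochner_integral_sum has_bochner_integral_cos_fejer assms)
  moreover have "(\<Sum>m\<in>M. \<Sum>k\<in>M. cos (y * (l * of_int (m - k))) * fejer d y)
      = fejer d y * (cmod (\<Sum>m\<in>M. cis (l * of_int m * y)))\<^sup>2" for y
  proof -
    have "(cmod (\<Sum>m\<in>M. cis (l * of_int m * y)))\<^sup>2
        = (\<Sum>m\<in>M. cos (l * of_int m * y))\<^sup>2 + (\<Sum>m\<in>M. sin (l * of_int m * y))\<^sup>2"
      by (simp add: cmod_power2 cis.simps(1) Re_sum Im_sum)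
    also have "\<dots> = (\<Sum>m\<in>M. \<Sum>k\<in>M. cos (y * (l * of_int (m - k))))"
      unfolding power2_eq_square sum_product
      by (simp flip: sum.distrib cos_diff add: algebra_simps)
    finally show ?thesis
      by (simp add: sum_distrib_left mult_ac)
  qed
  moreover have "(\<Sum>m\<in>M. \<Sum>k\<in>M. tent d (l * of_int (m - k))) = card M"
  proof -
    \<comment> \<open>Distinct multiples of \<open>l\<close> are at least \<open>l\<close> apart,
      hence at least \<open>d\<close>, where the tent has reached 0.\<close>
    have "tent d (l * of_int (m - k)) = (if k = m then 1 else 0)" for m k :: int
    proof (cases "k = m")
      case False
      then have "1 \<le> \<bar>m - k\<bar>" by linarith
      then have "(1::real) \<le> \<bar>of_int (m - k)\<bar>" by linarith
      then have "l * 1 \<le> l * \<bar>of_int (m - k)\<bar>"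
        using assms by (intro mult_left_mono) auto
      also have "\<dots> = \<bar>l * of_int (m - k)\<bar>"
        using assms by (simp add: abs_mult)
      finally have "d \<le> \<bar>l * of_int (m - k)\<bar>"
        using assms by linarith
      then show ?thesis
        using assms False by (simp add: tent_eq_0)
    qed (simp add: tent_def)
    then show ?thesis
      using \<open>finite M\<close> by simp
  qed
  ultimately show ?thesis by simp
qed

text \<open>Of the two kernel factors in the square, one is bounded by its maximum
  \<open>d / (2 * pi)\<close> and the other is kept as the weight that makes the characters
  orthonormal. This bounds the norm without Plancherel's theorem.\<close>

lemma
  assumes "0 < d" "d \<le> l" "finite M"
  shows integrable_cmod_comb_fun_squared: "integrable lborel (\<lambda>y. (cmod (comb_fun d l M y))\<^sup>2)"
    and integral_cmod_comb_fun_squared_le: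
      "(LINT y|lborel. (cmod (comb_fun d l M y))\<^sup>2) \<le> d / (2 * pi) * card M"
proof -
  let ?P = "\<lambda>y. (cmod (\<Sum>m\<in>M. cis (l * of_int m * y)))\<^sup>2"
  have bound: "has_bochner_integral lborel (\<lambda>y. d / (2 * pi) * (fejer d y * ?P y)) (d / (2 * pi) * card M)"
    by (intro has_bochner_integral_mult_right has_bochner_integral_fejer_trig_poly assms)
  have le: "(cmod (comb_fun d l M y))\<^sup>2 \<le> d / (2 * pi) * (fejer d y * ?P y)" for y
  proof -
    have "(cmod (comb_fun d l M y))\<^sup>2 = fejer d y * (fejer d y * ?P y)"
      by (simp add: comb_fun_def norm_mult power_mult_distrib power2_eq_square)
    also have "\<dots> \<le> d / (2 * pi) * (fejer d y * ?P y)"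
      by (intro mult_right_mono fejer_le mult_nonneg_nonneg fejer_nonneg assms) auto
    finally show ?thesis .
  qed
  show int: "integrable lborel (\<lambda>y. (cmod (comb_fun d l M y))\<^sup>2)"
  proof (rule Bochner_Integration.integrable_bound)
    show "integrable lborel (\<lambda>y. d / (2 * pi) * (fejer d y * ?P y))"
      using bound by (simp add: has_bochner_integral_iff)
    show "AE y in lborel. norm ((cmod (comb_fun d l M y))\<^sup>2) \<le> norm (d / (2 * pi) * (fejer d y * ?P y))"
    proof (intro AE_I2)
      fix y
      have "norm ((cmod (comb_fun d l M y))\<^sup>2) = (cmod (comb_fun d l M y))\<^sup>2" by simp
      also note le
      also note abs_ge_self
      finally show "norm ((cmod (comb_fun d l M y))\<^sup>2) \<le> norm (d / (2 * pi) * (fejer d y * ?P y))"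
        by simp
    qed
  qed measurable
  have "(LINT y|lborel. (cmod (comb_fun d l M y))\<^sup>2) \<le> (LINT y|lborel. d / (2 * pi) * (fejer d y * ?P y))"
    using bound by (intro integral_mono int le) (auto simp: has_bochner_integral_iff)
  also have "\<dots> = d / (2 * pi) * card M"
    using bound by (rule has_bochner_integral_integral_eq)
  finally show "(LINT y|lborel. (cmod (comb_fun d l M y))\<^sup>2) \<le> d / (2 * pi) * card M" .
qed

section \<open>Mass of the combs, and oscillatory integrals without cancellation\<close>

lemma integrable_tent:
  assumes "0 < d"
  shows "integrable lborel (\<lambda>s. tent d (s - c))"
proof (rule Bochner_Integration.integrable_bound[where f = "indicat_real {c - d..c + d}"])
  show "AE s in lborel. norm (tent d (s - c)) \<le> norm (indicat_real {c - d..c + d} s)"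
    by (intro AE_I2) (use assms in \<open>auto simp: tent_def indicator_def max_def abs_if field_simps\<close>)
qed (use assms in \<open>auto simp: integrable_indicator_iff\<close>)

text \<open>The tent is at least 1/2 on the interval of length \<open>d\<close> around its
  centre.\<close>

lemma integral_tent_ge:
  assumes "0 < d"
  shows "d / 2 \<le> (LINT s|lborel. tent d (s - c))"
proof -
  have "(LINT s|lborel. 1/2 * indicat_real {c - d/2..c + d/2} s) \<le> (LINT s|lborel. tent d (s - c))"
    by (intro integral_mono integrable_tent assms integrable_mult_right)
       (simp add: integrable_indicator_iff,
        use assms in \<open>auto simp: tent_def indicator_def max_def abs_if field_simps\<close>)
  then show ?thesis using assms by simp
qed

lemma integrable_comb_hat: "0 < d \<Longrightarrow> integrable lborel (comb_hat d l M)"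
  unfolding comb_hat_def by (intro Bochner_Integration.integrable_sum integrable_tent)

lemma integral_comb_hat_ge:
  fixes d :: real
  assumes "0 < d"
  shows "card M * d / 2 \<le> (LINT s|lborel. comb_hat d l M s)"
proof -
  have "card M * d / 2 = (\<Sum>m\<in>M. d / 2)" by simp
  also have "\<dots> \<le> (\<Sum>m\<in>M. LINT s|lborel. tent d (s - l * of_int m))"
    by (intro sum_mono integral_tent_ge assms)
  also have "\<dots> = (LINT s|lborel. comb_hat d l M s)"
    unfolding comb_hat_def by (intro Bochner_Integration.integral_sum[symmetric] integrable_tent assms)
  finally show ?thesis .
qed

lemma comb_hat_neq_0D:
  assumes "0 < d" "comb_hat d l M s \<noteq> 0"
  obtains m where "m \<in> M" "\<bar>s - l * of_int m\<bar> < d"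
  using assms tent_eq_0 by (force simp: comb_hat_def elim: sum.not_neutral_contains_not_neutral)

text \<open>The modulus is at least the real part. Where \<open>h\<close> is nonzero, the phase is
  within \<open>1 < pi / 3\<close> of a multiple of \<open>2 * pi\<close>, so its cosine is at least
  1/2.\<close>

lemma norm_integral_cis_ge:
  fixes h \<phi> :: "real \<Rightarrow> real"
  assumes h: "integrable lborel h" "\<And>s. 0 \<le> h s"
    and [measurable]: "\<phi> \<in> borel_measurable borel"
    and phase: "\<And>s. h s \<noteq> 0 \<Longrightarrow> \<exists>k::int. \<bar>\<phi> s - 2 * pi * of_int k\<bar> \<le> 1"
  shows "(LINT s|lborel. h s) / 2 \<le> cmod (LINT s|lborel. cis (\<phi> s) * complex_of_real (h s))"
proof -
  have [measurable]: "h \<in> borel_measurable borel"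
    using h(1) by auto
  have int: "integrable lborel (\<lambda>s. cis (\<phi> s) * complex_of_real (h s))"
    by (rule Bochner_Integration.integrable_bound[OF h(1)])
       (auto simp: norm_mult cis_conv_exp)
  have cos_ge: "1 / 2 * h s \<le> cos (\<phi> s) * h s" for s
  proof (cases "h s = 0")
    case False
    then obtain k :: int where k: "\<bar>\<phi> s - 2 * pi * of_int k\<bar> \<le> 1"
      using phase by blast
    let ?x = "\<phi> s - 2 * pi * of_int k"
    have "\<bar>?x\<bar> \<le> pi / 3"
      using k pi_gt3 by linarith
    then have "1 / 2 \<le> cos \<bar>?x\<bar>"
      using cos_monotone_0_pi_le[of "\<bar>?x\<bar>" "pi / 3"] by (simp add: cos_60)
    moreover have "cos ?x = cos (\<phi> s)"
      by (simp add: cos_diff cos_int_2pin sin_int_2pin)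
    ultimately show ?thesis
      using h(2)[of s] by (intro mult_right_mono) auto
  qed simp
  have "(LINT s|lborel. h s) / 2 = (LINT s|lborel. 1 / 2 * h s)"
    by simp
  also have "\<dots> \<le> (LINT s|lborel. Re (cis (\<phi> s) * complex_of_real (h s)))"
    using cos_ge h(1) by (intro integral_mono integrable_Re int) auto
  also have "\<dots> = Re (LINT s|lborel. cis (\<phi> s) * complex_of_real (h s))"
    using int by (rule integral_Re)
  also have "\<dots> \<le> cmod (LINT s|lborel. cis (\<phi> s) * complex_of_real (h s))"
    by (rule complex_Re_le_cmod)
  finally show ?thesis .
qed

subsection \<open>Tensor products of combs\<close>

definition comb_wave :: "real \<Rightarrow> real \<Rightarrow> int set \<Rightarrow> 'a::euclidean_space \<Rightarrow> complex" where
  "comb_wave d l M x = (\<Prod>b\<in>Basis. comb_fun d l M (x \<bullet> b))"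

definition comb_wave_hat :: "real \<Rightarrow> real \<Rightarrow> int set \<Rightarrow> 'a::euclidean_space \<Rightarrow> complex" where
  "comb_wave_hat d l M \<xi> = (\<Prod>b\<in>Basis. complex_of_real (comb_hat d l M (\<xi> \<bullet> b)))"

lemma comb_wave_measurable [measurable]: "comb_wave d l M \<in> borel_measurable borel"
  unfolding comb_wave_def by measurable

lemma comb_wave_hat_measurable [measurable]: "comb_wave_hat d l M \<in> borel_measurable borel"
  unfolding comb_wave_hat_def by measurable

lemma cis_inner: "cis (x \<bullet> \<xi>) = (\<Prod>b\<in>Basis. cis ((x \<bullet> b) * (\<xi> \<bullet> b)))"
  by (simp add: euclidean_inner[of x \<xi>] cis_conv_exp sum_distrib_left exp_sum)

lemma integrable_comb_wave: "0 < d \<Longrightarrow> integrable lborel (comb_wave d l M)"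
  unfolding comb_wave_def by (intro integrable_lborel_prod_Basis integrable_comb_fun)

lemma integrable_comb_wave_hat: "0 < d \<Longrightarrow> integrable lborel (comb_wave_hat d l M)"
  unfolding comb_wave_hat_def
  by (intro integrable_lborel_prod_Basis integrable_of_real integrable_comb_hat)

text \<open>The character \<open>cis (- (x \<bullet> \<xi>))\<close> factors over the coordinates,
  so the transform is a product of one-dimensional ones.\<close>

lemma fourier_integral_comb_wave:
  assumes "0 < d"
  shows "fourier_integral (comb_wave d l M) = comb_wave_hat d l M"
proof
  fix \<xi> :: 'a
  have "fourier_integral (comb_wave d l M) \<xi>
      = (LINT x|lborel. exp (- \<i> * complex_of_real (x \<bullet> \<xi>)) * comb_wave d l M x)"
    unfolding fourier_integral_def by (rule integral_completion) measurable
  also have "\<dots> = (LINT x|lborel. (\<Prod>b\<in>Basis. cis (- ((x \<bullet> b) * (\<xi> \<bullet> b))) * comb_fun d l M (x \<bullet> b)))"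
    using cis_inner[of _ "- \<xi>"]
    by (intro Bochner_Integration.integral_cong) (simp_all add: comb_wave_def prod.distrib cis_conv_exp)
  also have "\<dots> = (\<Prod>b\<in>Basis. LINT y|lborel. cis (- (y * (\<xi> \<bullet> b))) * comb_fun d l M y)"
    using has_bochner_integral_comb_fun[OF assms]
    by (intro integral_lborel_prod_Basis[where g = "\<lambda>b y. cis (- (y * (\<xi> \<bullet> b))) * comb_fun d l M y"])
       (simp add: has_bochner_integral_iff)
  also have "\<dots> = comb_wave_hat d l M \<xi>"
    using has_bochner_integral_comb_fun[OF assms]
    by (simp add: comb_wave_hat_def has_bochner_integral_iff)
  finally show "fourier_integral (comb_wave d l M) \<xi> = comb_wave_hat d l M \<xi>" .
qed

lemma cmod_comb_wave_squared:
  "(cmod (comb_wave d l M x))\<^sup>2 = (\<Prod>b\<in>Basis. (cmod (comb_fun d l M (x \<bullet> b)))\<^sup>2)"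
  by (simp add: comb_wave_def prod_norm[symmetric] prod_power_distrib)

lemma square_integrable_comb_wave:
  assumes "0 < d" "d \<le> l" "finite M"
  shows "square_integrable (comb_wave d l M)"
  unfolding square_integrable_def
proof
  show "integrable lebesgue (\<lambda>x. (cmod (comb_wave d l M x))\<^sup>2)"
    unfolding cmod_comb_wave_squared
    by (subst integrable_completion)
       (auto intro!: integrable_lborel_prod_Basis integrable_cmod_comb_fun_squared assms)
qed (auto intro: measurable_completion)

lemma L2_norm_on_comb_wave_le:
  assumes "0 < d" "d \<le> l" "finite M"
  shows "L2_norm_on UNIV (comb_wave d l M :: 'a::euclidean_space \<Rightarrow> complex)
    \<le> sqrt ((d / (2 * pi) * card M) ^ DIM('a))"
proof -
  have "(LINT x:UNIV|lebesgue. (cmod (comb_wave d l M (x::'a)))\<^sup>2)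
      = (LINT x|lborel. (\<Prod>b\<in>(Basis::'a set). (cmod (comb_fun d l M (x \<bullet> b)))\<^sup>2))"
    unfolding set_lebesgue_integral_def cmod_comb_wave_squared
    by (subst integral_completion) auto
  also have "\<dots> = (\<Prod>b\<in>(Basis::'a set). LINT y|lborel. (cmod (comb_fun d l M y))\<^sup>2)"
    by (intro integral_lborel_prod_Basis integrable_cmod_comb_fun_squared assms)
  also have "\<dots> \<le> (d / (2 * pi) * card M) ^ DIM('a)"
    using integral_cmod_comb_fun_squared_le[OF assms] by (simp add: power_mono)
  finally show ?thesis
    unfolding L2_norm_on_def by (rule real_sqrt_le_mono)
qed

lemma comb_hat_le:
  assumes "0 < d"
  shows "comb_hat d l M s \<le> card M"
proof -
  have "comb_hat d l M s \<le> (\<Sum>m\<in>M. 1)"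
    unfolding comb_hat_def using assms by (intro sum_mono) (simp add: tent_def)
  then show ?thesis by simp
qed

text \<open>In each coordinate the comb is integrable and bounded by \<open>card M\<close>, so its
  square is dominated by \<open>card M\<close> times the comb.\<close>

lemma square_integrable_comb_wave_hat:
  assumes "0 < d"
  shows "square_integrable (comb_wave_hat d l M)"
  unfolding square_integrable_def
proof
  have "integrable lborel (\<lambda>s. (comb_hat d l M s)\<^sup>2)"
  proof (rule Bochner_Integration.integrable_bound)
    show "integrable lborel (\<lambda>s. card M * comb_hat d l M s)"
      by (intro integrable_mult_right integrable_comb_hat assms)
    show "AE s in lborel. norm ((comb_hat d l M s)\<^sup>2) \<le> norm (card M * comb_hat d l M s)"
      using comb_hat_le[OF assms, of l M] comb_hat_nonneg[of d l M]
      by (intro AE_I2) (simp add: power2_eq_square mult_right_mono)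
  qed measurable
  then show "integrable lebesgue (\<lambda>\<xi>. (cmod (comb_wave_hat d l M \<xi>))\<^sup>2)"
    by (subst integrable_completion)
       (auto simp: comb_wave_hat_def prod_norm[symmetric] prod_power_distrib
        intro!: integrable_lborel_prod_Basis)
qed (auto intro: measurable_completion)

lemma has_fourier_transform_comb_wave:
  assumes "0 < d" "d \<le> l" "finite M"
  shows "has_fourier_transform (comb_wave d l M) (comb_wave_hat d l M)"
  unfolding has_fourier_transform_def
\<comment> \<open>The wave is integrable itself, so a constant approximating sequence serves and
  both error sequences are identically 0.\<close>
proof (intro conjI exI[of _ "\<lambda>_. comb_wave d l M"] allI)
  show "integrable lebesgue (comb_wave d l M)"
    by (subst integrable_completion) (auto intro: integrable_comb_wave assms)
qed (use assms in \<open>simp_all add: fourier_integral_comb_wave square_integrable_comb_wave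
      square_integrable_comb_wave_hat L2_norm_on_def\<close>)

text \<open>If the wave vanished almost everywhere, so would its integral. That integral is the
  transform at the origin, which is positive because the tent of \<open>m = 0\<close> has value 1
  there.\<close>

lemma comb_wave_not_AE_0:
  assumes "0 < d" "finite M" "0 \<in> M"
  shows "\<not> (AE x in lebesgue. comb_wave d l M (x :: 'a::euclidean_space) = 0)"
proof
  assume *: "AE x in lebesgue. comb_wave d l M (x :: 'a) = 0"
  have "fourier_integral (comb_wave d l M) (0 :: 'a) = (LINT x|lebesgue. comb_wave d l M (x :: 'a))"
    by (simp add: fourier_integral_def)
  also have "\<dots> = 0"
    using * by (rule integral_eq_zero_AE)
  finally have "comb_wave_hat d l M (0 :: 'a) = 0"
    by (simp add: fourier_integral_comb_wave assms)
  then have "comb_hat d l M 0 = 0"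
    by (auto simp: comb_wave_hat_def)
  moreover have "tent d (0 - l * of_int 0) \<le> comb_hat d l M 0"
    unfolding comb_hat_def using assms
    by (intro member_le_sum[where f = "\<lambda>m. tent d (0 - l * of_int m)"]) (auto simp: tent_def)
  ultimately show False
    by (simp add: tent_def)
qed

text \<open>Outside the unit cube some coordinate exceeds 1/2 in absolute value. The margin
  \<open>d\<close> in the bound on the centres leaves room for the half-width of the tents.\<close>

lemma comb_wave_hat_eq_0:
  assumes "0 < d" "\<And>m. m \<in> M \<Longrightarrow> \<bar>l * of_int m\<bar> \<le> 1/2 - d" "\<xi> \<notin> cube 1 0"
  shows "comb_wave_hat d l M \<xi> = 0"
proof -
  obtain b where b: "b \<in> Basis" "1/2 < \<bar>\<xi> \<bullet> b\<bar>"
    using assms(3) by (force simp: cube_def mem_box abs_le_iff)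
  have "comb_hat d l M (\<xi> \<bullet> b) = 0"
  proof (rule ccontr)
    assume "comb_hat d l M (\<xi> \<bullet> b) \<noteq> 0"
    then obtain m where "m \<in> M" "\<bar>\<xi> \<bullet> b - l * of_int m\<bar> < d"
      using comb_hat_neq_0D assms(1) by blast
    with assms(2)[of m] b(2) show False by linarith
  qed
  then show ?thesis
    unfolding comb_wave_hat_def using b(1) by (intro prod_zero) auto
qed

section \<open>Lower bounds for the solution, pointwise and in L2\<close>

text \<open>Both parts of the phase are sums over coordinates, so the evolution is a product of
  one-dimensional integrals. Each keeps half of a comb mass of at least
  \<open>card M * d / 2\<close>; the prefactor contributes \<open>1 / (2 * pi)\<close> per
  coordinate, which gives \<open>8 * pi\<close>.\<close>

lemma cmod_schroedinger_comb_wave_hat_ge: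
  fixes x :: "real ^ 'n" and d t :: real
  assumes "0 < d"
    and phase: "\<And>i s. comb_hat d l M s \<noteq> 0 \<Longrightarrow>
      \<exists>k::int. \<bar>x $ i * s + t * s\<^sup>2 - 2 * pi * of_int k\<bar> \<le> 1"
  shows "(card M * d / (8 * pi)) ^ CARD('n) \<le> cmod (schroedinger (comb_wave_hat d l M) (x, t))"
proof -
  let ?h = "comb_hat d l M"
  let ?I = "\<lambda>b::real^'n. LINT s|lborel. cis ((x \<bullet> b) * s + t * s\<^sup>2) * complex_of_real (?h s)"
  have prod: "exp (\<i> * complex_of_real (x \<bullet> \<xi>)) * exp (\<i> * complex_of_real (t * (norm \<xi>)\<^sup>2)) * comb_wave_hat d l M \<xi>
      = (\<Prod>b\<in>Basis. cis ((x \<bullet> b) * (\<xi> \<bullet> b) + t * (\<xi> \<bullet> b)\<^sup>2) * complex_of_real (?h (\<xi> \<bullet> b)))" for \<xi> :: "real^'n"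
  proof -
    have "exp (\<i> * complex_of_real (x \<bullet> \<xi>)) * exp (\<i> * complex_of_real (t * (norm \<xi>)\<^sup>2))
        = cis (x \<bullet> \<xi>) * cis ((t *\<^sub>R \<xi>) \<bullet> \<xi>)"
      by (simp add: cis_conv_exp power2_norm_eq_inner)
    also have "\<dots> = (\<Prod>b\<in>Basis. cis ((x \<bullet> b) * (\<xi> \<bullet> b)) * cis (((t *\<^sub>R \<xi>) \<bullet> b) * (\<xi> \<bullet> b)))"
      by (simp only: cis_inner prod.distrib)
    also have "\<dots> = (\<Prod>b\<in>Basis. cis ((x \<bullet> b) * (\<xi> \<bullet> b) + t * (\<xi> \<bullet> b)\<^sup>2))"
      by (simp add: cis_mult power2_eq_square mult.assoc)
    finally show ?thesis
      by (simp add: comb_wave_hat_def prod.distrib)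
  qed
  have "(LINT \<xi>|lebesgue. exp (\<i> * complex_of_real (x \<bullet> \<xi>)) *
        exp (\<i> * complex_of_real (t * (norm \<xi>)\<^sup>2)) * comb_wave_hat d l M \<xi>)
      = (LINT \<xi>|lborel. exp (\<i> * complex_of_real (x \<bullet> \<xi>)) *
        exp (\<i> * complex_of_real (t * (norm \<xi>)\<^sup>2)) * comb_wave_hat d l M \<xi>)"
    by (rule integral_completion) measurable
  also have "\<dots> = (\<Prod>b\<in>Basis. ?I b)"
    unfolding prod
  proof (rule integral_lborel_prod_Basis)
    show "integrable lborel (\<lambda>s. cis ((x \<bullet> b) * s + t * s\<^sup>2) * complex_of_real (?h s))" for b
      by (rule Bochner_Integration.integrable_bound[OF integrable_comb_hat[OF assms(1), of l M]])
         (auto simp: norm_mult cis_conv_exp)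
  qed
  finally have eq: "schroedinger (comb_wave_hat d l M) (x, t) = complex_of_real (1 / (2 * pi) ^ CARD('n)) * (\<Prod>b\<in>Basis. ?I b)"
    by (simp add: schroedinger_def)
  have ge: "card M * d / 4 \<le> cmod (?I b)" if b: "b \<in> Basis" for b
  proof -
    obtain i where i: "x \<bullet> b = x $ i"
      using b by (auto simp: Basis_vec_def inner_axis)
    have "card M * d / 4 \<le> (LINT s|lborel. ?h s) / 2"
      using integral_comb_hat_ge[OF assms(1), of M l] by (simp add: mult.commute)
    also have "\<dots> \<le> cmod (?I b)"
      unfolding i using phase
      by (intro norm_integral_cis_ge integrable_comb_hat comb_hat_nonneg assms(1)) auto
    finally show ?thesis .
  qed
  have "card M * d / (8 * pi) = 1 / (2 * pi) * (card M * d / 4)"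
    by simp
  then have "(card M * d / (8 * pi)) ^ CARD('n) = (1 / (2 * pi)) ^ CARD('n) * (card M * d / 4) ^ CARD('n)"
    by (simp only: power_mult_distrib)
  then have "(card M * d / (8 * pi)) ^ CARD('n) = 1 / (2 * pi) ^ CARD('n) * (\<Prod>b\<in>(Basis::(real^'n) set). card M * d / 4)"
    by (simp add: power_one_over)
  also have "\<dots> \<le> 1 / (2 * pi) ^ CARD('n) * (\<Prod>b\<in>Basis. cmod (?I b))"
    using ge assms(1) by (intro mult_left_mono prod_mono) auto
  also have "\<dots> = cmod (schroedinger (comb_wave_hat d l M) (x, t))"
    unfolding eq by (simp add: norm_mult prod_norm norm_divide norm_power)
  finally show ?thesis .
qed

lemma schroedinger_borel_measurable:
  fixes g :: "real ^ 'n \<Rightarrow> complex"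
  assumes [measurable]: "g \<in> borel_measurable borel"
  shows "schroedinger g \<in> borel_measurable borel"
proof -
  have eq: "schroedinger g = (\<lambda>z. complex_of_real (1 / (2 * pi) ^ CARD('n)) *
     (LINT \<xi>|lborel. exp (\<i> * complex_of_real (fst z \<bullet> \<xi>)) *
        exp (\<i> * complex_of_real (snd z * (norm \<xi>)\<^sup>2)) * g \<xi>))"
    unfolding schroedinger_def
    by (auto simp: fun_eq_iff intro!: integral_completion)
  show ?thesis
    unfolding eq borel_prod[symmetric] by measurable
qed

text \<open>Provides the uniform bound \<open>B\<close> required by
  \<open>L2_norm_on_ge\<close>.\<close>

lemma cmod_schroedinger_le:
  fixes g :: "real ^ 'n \<Rightarrow> complex"
  assumes "integrable lborel g"
  shows "cmod (schroedinger g z) \<le> 1 / (2 * pi) ^ CARD('n) * (LINT \<xi>|lborel. cmod (g \<xi>))"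
proof -
  obtain x t where z: "z = (x, t)" by fastforce
  have [measurable]: "g \<in> borel_measurable borel"
    using assms by auto
  let ?G = "\<lambda>\<xi>. exp (\<i> * complex_of_real (x \<bullet> \<xi>)) *
        exp (\<i> * complex_of_real (t * (norm \<xi>)\<^sup>2)) * g \<xi>"
  have "cmod (LINT \<xi>|lebesgue. ?G \<xi>) = cmod (LINT \<xi>|lborel. ?G \<xi>)"
    by (subst integral_completion) auto
  also have "\<dots> \<le> (LINT \<xi>|lborel. cmod (?G \<xi>))"
    by (rule integral_norm_bound)
  also have "\<dots> = (LINT \<xi>|lborel. cmod (g \<xi>))"
    by (simp add: norm_mult)
  finally show ?thesis
    unfolding z schroedinger_def by (simp add: norm_mult norm_divide norm_power divide_right_mono)
qed

text \<open>The Bochner integral of a non-integrable function is 0 by convention, so a pointwise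
  lower bound passes to the norm only once the square is integrable on \<open>S\<close>. Boundedness
  of \<open>S\<close> and of \<open>u\<close> ensures that.\<close>

lemma L2_norm_on_ge:
  fixes u :: "'a::euclidean_space \<Rightarrow> complex"
  assumes S: "S \<in> sets borel" "bounded S"
    and u: "u \<in> borel_measurable borel" "\<And>z. cmod (u z) \<le> B"
    and lower: "\<And>z. z \<in> S \<Longrightarrow> c \<le> cmod (u z)" and "0 \<le> c"
  shows "c * sqrt (measure lebesgue S) \<le> L2_norm_on S u"
proof -
  have [measurable]: "S \<in> sets borel" "u \<in> borel_measurable borel" by fact+
  have fin: "emeasure lborel S < \<infinity>"
    using S(2) by (rule emeasure_bounded_finite)
  have fin': "integrable lborel (indicat_real S)"
    using fin by (simp add: integrable_indicator_iff)
  have B: "(cmod (u z))\<^sup>2 \<le> B\<^sup>2" for z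
    using u(2)[of z] by (intro power_mono) auto
  have int: "integrable lborel (\<lambda>z. indicat_real S z * (cmod (u z))\<^sup>2)"
  proof (rule Bochner_Integration.integrable_bound)
    show "integrable lborel (\<lambda>z. B\<^sup>2 * indicat_real S z)"
      by (intro integrable_mult_right fin')
    show "AE z in lborel. norm (indicat_real S z * (cmod (u z))\<^sup>2) \<le> norm (B\<^sup>2 * indicat_real S z)"
      using B by (intro AE_I2) (auto simp: indicator_def)
  qed measurable
  have "c\<^sup>2 * measure lebesgue S = (LINT z|lborel. c\<^sup>2 * indicat_real S z)"
    using fin by simp
  also have "\<dots> \<le> (LINT z|lborel. indicat_real S z * (cmod (u z))\<^sup>2)"
    using fin lower \<open>0 \<le> c\<close>
    by (intro integral_mono int integrable_mult_right fin') (auto simp: indicator_def intro!: power_mono)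
  also have "\<dots> = (LINT z:S|lebesgue. (cmod (u z))\<^sup>2)"
    unfolding set_lebesgue_integral_def by (subst integral_completion) auto
  finally have "sqrt (c\<^sup>2 * measure lebesgue S) \<le> L2_norm_on S u"
    unfolding L2_norm_on_def by (rule real_sqrt_le_mono)
  then show ?thesis
    using \<open>0 \<le> c\<close> by (simp add: real_sqrt_mult)
qed

text \<open>At the lattice point \<open>X\<close>, \<open>T\<close> and the frequency
  \<open>l * m\<close> the phase is exactly a multiple of \<open>2 * pi\<close>. The deviation
  splits into four errors: moving \<open>x\<close> costs at most 1/4, and moving \<open>t\<close>,
  moving the frequency against \<open>X\<close> and moving it against \<open>T\<close> cost at most
  1/8 each. The last two use that \<open>1 / (4 * R)\<close> compensates
  \<open>\<bar>X\<bar>\<close> and \<open>\<bar>T\<bar>\<close>, which are at most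
  \<open>R / 2\<close>.\<close>

lemma schroedinger_phase_close:
  fixes j k m :: int and l R s t x :: real
  assumes "1 \<le> R" "0 < l"
    and m: "\<bar>l * m\<bar> \<le> 1/4" and s: "\<bar>s - l * m\<bar> \<le> 1 / (4 * R)"
    and x: "\<bar>x - 2 * pi / l * k\<bar> \<le> 1/2" "\<bar>2 * pi / l * k\<bar> \<le> R / 2"
    and t: "\<bar>t - 2 * pi / l\<^sup>2 * j\<bar> \<le> 1/2" "\<bar>2 * pi / l\<^sup>2 * j\<bar> \<le> R / 2"
  shows "\<bar>x * s + t * s\<^sup>2 - 2 * pi * of_int (k * m + j * m\<^sup>2)\<bar> \<le> 1"
proof -
  define u where "u = s - l * m"
  define X where "X = 2 * pi / l * k"
  define T where "T = 2 * pi / l\<^sup>2 * j"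
  have u: "\<bar>u\<bar> \<le> 1 / (4 * R)" using s by (simp add: u_def)
  have "1 / (4 * R) \<le> 1/4" using assms(1) by (simp add: field_simps)
  with u have u4: "\<bar>u\<bar> \<le> 1/4" by linarith
  have s2: "\<bar>s\<bar> \<le> 1/2" using m u4 unfolding u_def by linarith
  have "\<bar>X * u\<bar> \<le> R / 2 * (1 / (4 * R))"
    unfolding abs_mult using x(2) u assms(1) by (intro mult_mono) (auto simp: X_def)
  then have 1: "\<bar>X * u\<bar> \<le> 1/8" using assms(1) by simp
  have "\<bar>(x - X) * s\<bar> \<le> 1/2 * (1/2)"
    unfolding abs_mult using x(1) s2 by (intro mult_mono) (auto simp: X_def)
  then have 2: "\<bar>(x - X) * s\<bar> \<le> 1/4" by simp
  have "\<bar>2 * (l * m) + u\<bar> \<le> 1" using m u4 by linarith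
  then have "\<bar>u * (2 * (l * m) + u)\<bar> \<le> 1 / (4 * R) * 1"
    unfolding abs_mult using u assms(1) by (intro mult_mono) auto
  then have "\<bar>T * (u * (2 * (l * m) + u))\<bar> \<le> R / 2 * (1 / (4 * R))"
    unfolding abs_mult[of T] using t(2) assms(1) by (intro mult_mono) (auto simp: T_def)
  then have 3: "\<bar>T * (u * (2 * (l * m) + u))\<bar> \<le> 1/8" using assms(1) by simp
  have "\<bar>(t - T) * (s * s)\<bar> \<le> 1/2 * (1/2 * (1/2))"
    unfolding abs_mult using t(1) s2 by (intro mult_mono) (auto simp: T_def)
  then have 4: "\<bar>(t - T) * (s * s)\<bar> \<le> 1/8" by simp
  have Xl: "X * (l * m) = 2 * pi * (k * m)" and Tl: "T * (l * m)\<^sup>2 = 2 * pi * (j * m\<^sup>2)"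
    using assms(2) by (simp_all add: X_def T_def power_mult_distrib)
  have "x * s + t * s\<^sup>2 = (x - X) * s + X * u + (t - T) * (s * s) + T * (u * (2 * (l * m) + u))
      + (X * (l * m) + T * (l * m)\<^sup>2)"
    by (simp add: u_def algebra_simps power2_eq_square)
  then have "x * s + t * s\<^sup>2 - 2 * pi * of_int (k * m + j * m\<^sup>2)
      = (x - X) * s + X * u + (t - T) * (s * s) + T * (u * (2 * (l * m) + u))"
    unfolding Xl Tl by (simp add: algebra_simps)
  with 1 2 3 4 show ?thesis by linarith
qed

subsection \<open>Periodic arrangements of unit cubes\<close>

definition slab_comb :: "real \<Rightarrow> real \<Rightarrow> real set" where
  "slab_comb p r = (\<Union>k\<in>{k::int. \<bar>p * of_int k\<bar> \<le> r}. {p * of_int k - 1/2..p * of_int k + 1/2})"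

lemma
  fixes u v :: real
  shows finite_int_between: "finite {k::int. u \<le> k \<and> k \<le> v}"
    and card_int_between: "card {k::int. u \<le> k \<and> k \<le> v} = nat (\<lfloor>v\<rfloor> - \<lceil>u\<rceil> + 1)"
proof -
  have "{k::int. u \<le> k \<and> k \<le> v} = {\<lceil>u\<rceil>..\<lfloor>v\<rfloor>}"
    by (auto simp: ceiling_le_iff le_floor_iff)
  then show "finite {k::int. u \<le> k \<and> k \<le> v}"
    and "card {k::int. u \<le> k \<and> k \<le> v} = nat (\<lfloor>v\<rfloor> - \<lceil>u\<rceil> + 1)"
    by simp_all
qed

lemma abs_mult_le_int_eq:
  assumes "0 < p"
  shows "{k::int. \<bar>p * of_int k\<bar> \<le> r} = {k. - (r / p) \<le> k \<and> k \<le> r / p}"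
  using assms by (auto simp: abs_le_iff field_simps)

lemma finite_abs_mult_le_int: "0 < (p::real) \<Longrightarrow> finite {k::int. \<bar>p * of_int k\<bar> \<le> r}"
  by (simp add: abs_mult_le_int_eq finite_int_between)

text \<open>The count is twice the floor of \<open>r / p\<close> plus 1, which exceeds
  \<open>r / p\<close> since the floor is nonnegative.\<close>

lemma card_abs_mult_le_int_ge:
  assumes "0 < p" "0 \<le> r"
  shows "r / p \<le> real (card {k::int. \<bar>p * of_int k\<bar> \<le> r})"
proof -
  have "0 \<le> \<lfloor>r / p\<rfloor>" using assms by simp
  then show ?thesis
    unfolding abs_mult_le_int_eq[OF assms(1)] card_int_between ceiling_minus
    using floor_correct[of "r / p"] by linarith
qed

lemma slab_comb_borel [measurable]: "0 < p \<Longrightarrow> slab_comb p r \<in> sets borel"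
  unfolding slab_comb_def abs_mult_le_int_eq by (intro sets.finite_UN finite_int_between) auto

lemma slab_comb_subset: "slab_comb p r \<subseteq> {- (r + 1/2)..r + 1/2}"
  unfolding slab_comb_def by (auto simp: abs_le_iff; smt (verit))

text \<open>Only intervals whose centres lie within 1/2 of the window meet it. Their indices fill a
  range of length \<open>(\<rho> + 1) / p\<close>, so there are at most
  \<open>(\<rho> + 1) / p + 1\<close> of them, and \<open>1 / p \<le> 1\<close>.\<close>

lemma measure_slab_comb_Int_le:
  assumes "0 < p" "1 \<le> p" "0 \<le> \<rho>"
  shows "measure lborel (slab_comb p r \<inter> {c - \<rho> / 2..c + \<rho> / 2}) \<le> 2 + \<rho> / p"
proof -
  let ?u = "(c - \<rho> / 2 - 1/2) / p" and ?v = "(c + \<rho> / 2 + 1/2) / p"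
  let ?K = "{k::int. ?u \<le> k \<and> k \<le> ?v}"
  have sub: "slab_comb p r \<inter> {c - \<rho> / 2..c + \<rho> / 2} \<subseteq> (\<Union>k\<in>?K. {p * of_int k - 1/2..p * of_int k + 1/2})"
  proof
    fix x assume "x \<in> slab_comb p r \<inter> {c - \<rho> / 2..c + \<rho> / 2}"
    then obtain k :: int where "x \<in> {p * of_int k - 1/2..p * of_int k + 1/2}" "x \<in> {c - \<rho> / 2..c + \<rho> / 2}"
      by (auto simp: slab_comb_def)
    moreover from this have "k \<in> ?K"
      using assms(1) by (simp add: pos_divide_le_eq pos_le_divide_eq mult.commute)
    ultimately show "x \<in> (\<Union>k\<in>?K. {p * of_int k - 1/2..p * of_int k + 1/2})"
      by blast
  qed
  have "measure lborel (slab_comb p r \<inter> {c - \<rho> / 2..c + \<rho> / 2})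
      \<le> measure lborel (\<Union>k\<in>?K. {p * of_int k - 1/2..p * of_int k + 1/2})"
    by (intro measure_mono_fmeasurable sub fmeasurable.finite_UN finite_int_between)
       (use assms in \<open>auto intro: fmeasurableI\<close>)
  also have "\<dots> \<le> (\<Sum>k\<in>?K. measure lborel {p * of_int k - 1/2..p * of_int k + 1/2})"
    by (intro measure_UNION_le finite_int_between) auto
  also have "\<dots> = real (card ?K)"
    by simp
  also have "\<dots> = real (nat (\<lfloor>?v\<rfloor> - \<lceil>?u\<rceil> + 1))"
    by (simp only: card_int_between)
  also have "\<dots> \<le> 2 + \<rho> / p"
  proof -
    have "?v - ?u = \<rho> / p + 1 / p"
      using assms(1) by (simp add: field_simps)
    moreover have "1 / p \<le> 1" "0 \<le> \<rho> / p"
      using assms by auto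
    ultimately show ?thesis
      using floor_correct[of ?v] ceiling_correct[of ?u] by linarith
  qed
  finally show ?thesis .
qed

text \<open>The strict bound \<open>1 < p\<close> separates the closed unit intervals, so the
  measure equals their number.\<close>

lemma measure_slab_comb_ge:
  assumes "1 < p" "0 \<le> r"
  shows "r / p \<le> measure lborel (slab_comb p r)"
proof -
  let ?K = "{k::int. - (r / p) \<le> k \<and> k \<le> r / p}"
  have K: "{k::int. \<bar>p * of_int k\<bar> \<le> r} = ?K"
    using assms by (intro abs_mult_le_int_eq) auto
  have disj: "disjoint_family_on (\<lambda>k. {p * of_int k - 1/2..p * of_int k + 1/2}) ?K"
    unfolding disjoint_family_on_def
  proof (intro ballI impI)
    fix k m :: int assume "k \<noteq> m"
    then have "1 \<le> \<bar>k - m\<bar>" by linarith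
    then have "(1::real) \<le> \<bar>of_int (k - m)\<bar>" by linarith
    then have "p * 1 \<le> p * \<bar>of_int (k - m)\<bar>"
      using assms by (intro mult_left_mono) auto
    also have "\<dots> = \<bar>p * of_int (k - m)\<bar>"
      using assms by (simp add: abs_mult)
    finally have "1 < \<bar>p * of_int k - p * of_int m\<bar>"
      using assms(1) by (simp add: right_diff_distrib)
    then show "{p * of_int k - 1/2..p * of_int k + 1/2} \<inter> {p * of_int m - 1/2..p * of_int m + 1/2} = {}"
      by auto
  qed
  have "r / p \<le> real (card ?K)"
    using card_abs_mult_le_int_ge[of p r] assms K by simp
  also have "\<dots> = (\<Sum>k\<in>?K. measure lborel {p * of_int k - 1/2..p * of_int k + 1/2})"
    by simp
  also have "\<dots> = measure lborel (\<Union>k\<in>?K. {p * of_int k - 1/2..p * of_int k + 1/2})"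
    by (intro measure_finite_Union[symmetric] finite_int_between disj) auto
  also have "\<dots> = measure lborel (slab_comb p r)"
    unfolding slab_comb_def K ..
  finally show ?thesis .
qed

lemma measure_lborel_box_Basis:
  assumes "\<And>b. b \<in> Basis \<Longrightarrow> A b \<in> sets borel" "\<And>b. b \<in> Basis \<Longrightarrow> bounded (A b)"
  shows "measure lborel {x::'a::euclidean_space. \<forall>b\<in>Basis. x \<bullet> b \<in> A b}
    = (\<Prod>b\<in>Basis. measure lborel (A b))"
proof -
  have "(LINT x|lborel. (\<Prod>b\<in>Basis. indicat_real (A b) (x \<bullet> b)))
      = (\<Prod>b\<in>(Basis::'a set). LINT y|lborel. indicat_real (A b) y)"
    using assms
    by (intro integral_lborel_prod_Basis)
       (auto simp: integrable_indicator_iff intro!: emeasure_bounded_finite[unfolded infinity_ennreal_def])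
  moreover have "(\<Prod>b\<in>Basis. indicat_real (A b) (x \<bullet> b)) = indicat_real {x. \<forall>b\<in>Basis. x \<bullet> b \<in> A b} x" for x :: 'a
    by (auto simp: indicator_def)
  ultimately show ?thesis
    by simp
qed

text \<open>In this coordinatewise form the measure of an intersection with a cube factors;
  \<open>slab_grid_eq_Union_cubes\<close> recovers the union of unit cubes.\<close>

definition slab_grid :: "('a::euclidean_space \<Rightarrow> real) \<Rightarrow> real \<Rightarrow> 'a set" where
  "slab_grid p r = {x. \<forall>b\<in>Basis. x \<bullet> b \<in> slab_comb (p b) r}"

lemma mem_cube: "x \<in> cube \<rho> c \<longleftrightarrow> (\<forall>b\<in>Basis. x \<bullet> b \<in> {c \<bullet> b - \<rho> / 2..c \<bullet> b + \<rho> / 2})"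
  by (simp add: cube_def mem_box inner_diff_left inner_add_left)

lemma slab_grid_eq_Union_cubes:
  "slab_grid p r = (\<Union>c\<in>{c. \<forall>b\<in>Basis. \<exists>k::int. c \<bullet> b = p b * of_int k \<and> \<bar>c \<bullet> b\<bar> \<le> r}. cube 1 c)"
proof (intro equalityI subsetI)
  fix x :: 'a assume "x \<in> slab_grid p r"
  then have "\<forall>b\<in>Basis. \<exists>k::int. \<bar>p b * of_int k\<bar> \<le> r \<and> x \<bullet> b \<in> {p b * of_int k - 1/2..p b * of_int k + 1/2}"
    by (auto simp: slab_grid_def slab_comb_def)
  then obtain k :: "'a \<Rightarrow> int" where k: "\<And>b. b \<in> Basis \<Longrightarrow> \<bar>p b * of_int (k b)\<bar> \<le> r"
    "\<And>b. b \<in> Basis \<Longrightarrow> x \<bullet> b \<in> {p b * of_int (k b) - 1/2..p b * of_int (k b) + 1/2}"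
    by metis
  define c where "c = (\<Sum>b\<in>Basis. (p b * of_int (k b)) *\<^sub>R b)"
  have c: "c \<bullet> b = p b * of_int (k b)" if "b \<in> Basis" for b
    using that by (simp add: c_def)
  show "x \<in> (\<Union>c\<in>{c. \<forall>b\<in>Basis. \<exists>k::int. c \<bullet> b = p b * of_int k \<and> \<bar>c \<bullet> b\<bar> \<le> r}. cube 1 c)"
    using k c by (intro UN_I[of c]) (auto simp: mem_cube)
qed (fastforce simp: slab_grid_def slab_comb_def mem_cube)

lemma slab_grid_borel:
  assumes "\<And>b. b \<in> Basis \<Longrightarrow> 0 < p b"
  shows "slab_grid p r \<in> sets borel"
proof -
  have "slab_grid p r = (\<Inter>b\<in>Basis. (\<lambda>x. x \<bullet> b) -` slab_comb (p b) r \<inter> space borel)"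
    by (auto simp: slab_grid_def)
  also have "\<dots> \<in> sets borel"
    using assms by (intro sets.finite_INT measurable_sets[where A = borel] slab_comb_borel) auto
  finally show ?thesis .
qed

text \<open>Centres within \<open>(R - 1) / 2\<close> leave the half unit that the cubes around them
  occupy.\<close>

lemma slab_grid_subset_cube: "r \<le> (R - 1) / 2 \<Longrightarrow> slab_grid p r \<subseteq> cube R 0"
  using slab_comb_subset by (fastforce simp: slab_grid_def mem_cube)

lemma measure_slab_grid_Int_cube:
  fixes p :: "'a::euclidean_space \<Rightarrow> real"
  assumes "\<And>b. b \<in> Basis \<Longrightarrow> 0 < p b"
  shows "measure lebesgue (slab_grid p r \<inter> cube \<rho> c)
    = (\<Prod>b\<in>Basis. measure lborel (slab_comb (p b) r \<inter> {c \<bullet> b - \<rho> / 2..c \<bullet> b + \<rho> / 2}))"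
proof -
  have "slab_grid p r \<inter> cube \<rho> c \<in> sets borel"
    using slab_grid_borel[of p r] assms by (auto simp: cube_def)
  moreover have "slab_grid p r \<inter> cube \<rho> c
      = {x. \<forall>b\<in>Basis. x \<bullet> b \<in> slab_comb (p b) r \<inter> {c \<bullet> b - \<rho> / 2..c \<bullet> b + \<rho> / 2}}"
    by (auto simp: slab_grid_def mem_cube)
  ultimately have "measure lebesgue (slab_grid p r \<inter> cube \<rho> c) = measure lborel
      {x. \<forall>b\<in>Basis. x \<bullet> b \<in> slab_comb (p b) r \<inter> {c \<bullet> b - \<rho> / 2..c \<bullet> b + \<rho> / 2}}"
    by simp
  also have "\<dots> = (\<Prod>b\<in>Basis. measure lborel (slab_comb (p b) r \<inter> {c \<bullet> b - \<rho> / 2..c \<bullet> b + \<rho> / 2}))"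
    using assms by (intro measure_lborel_box_Basis) (auto intro: bounded_subset[OF bounded_closed_interval])
  finally show ?thesis .
qed

lemma measure_slab_grid_Int_cube_le:
  fixes p :: "'a::euclidean_space \<Rightarrow> real"
  assumes "\<And>b. b \<in> Basis \<Longrightarrow> 1 \<le> p b" "0 \<le> \<rho>"
  shows "measure lebesgue (slab_grid p r \<inter> cube \<rho> c) \<le> (\<Prod>b\<in>Basis. 2 + \<rho> / p b)"
proof -
  have pos: "0 < p b" if "b \<in> Basis" for b
    using assms(1)[OF that] by simp
  show ?thesis
    by (subst measure_slab_grid_Int_cube)
       (use assms pos in \<open>auto intro!: prod_mono measure_slab_comb_Int_le\<close>)
qed

lemma measure_slab_grid_ge:
  fixes p :: "'a::euclidean_space \<Rightarrow> real"
  assumes "\<And>b. b \<in> Basis \<Longrightarrow> 1 < p b" "1 \<le> R"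
  shows "(\<Prod>b\<in>Basis. (R - 1) / 2 / p b) \<le> measure lebesgue (slab_grid p ((R - 1) / 2))"
proof -
  have pos: "0 < p b" if "b \<in> Basis" for b
    using assms(1)[OF that] by simp
  have "(\<Prod>b\<in>Basis. (R - 1) / 2 / p b) \<le> (\<Prod>b\<in>Basis. measure lborel (slab_comb (p b) ((R - 1) / 2)))"
    using assms pos by (intro prod_mono conjI measure_slab_comb_ge) (auto simp: less_imp_le)
  \<comment> \<open>The grid lies in \<open>cube R 0\<close>; intersecting with that cube changes
    nothing and makes the product formula for intersections applicable.\<close>
  also have "\<dots> = (\<Prod>b\<in>(Basis::'a set). measure lborel (slab_comb (p b) ((R - 1) / 2) \<inter> {0 \<bullet> b - R / 2..0 \<bullet> b + R / 2}))"
  proof (intro prod.cong refl)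
    fix b :: 'a
    have "slab_comb (p b) ((R - 1) / 2) \<inter> {0 \<bullet> b - R / 2..0 \<bullet> b + R / 2} = slab_comb (p b) ((R - 1) / 2)"
      using slab_comb_subset[of "p b" "(R - 1) / 2"] by (auto simp: field_simps)
    then show "measure lborel (slab_comb (p b) ((R - 1) / 2))
        = measure lborel (slab_comb (p b) ((R - 1) / 2) \<inter> {0 \<bullet> b - R / 2..0 \<bullet> b + R / 2})"
      by simp
  qed
  also have "\<dots> = measure lebesgue (slab_grid p ((R - 1) / 2) \<inter> cube R 0)"
    by (rule measure_slab_grid_Int_cube[OF pos, symmetric])
  also have "slab_grid p ((R - 1) / 2) \<inter> cube R 0 = slab_grid p ((R - 1) / 2)"
    using slab_grid_subset_cube[of "(R - 1) / 2" R p] by blast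
  finally show ?thesis .
qed

lemma prod_Basis_prod:
  "(\<Prod>b\<in>(Basis::('a::euclidean_space \<times> 'b::euclidean_space) set). g b)
    = (\<Prod>u\<in>Basis. g (u, 0)) * (\<Prod>v\<in>Basis. g (0, v))"
proof -
  have "(\<Prod>b\<in>(Basis::('a \<times> 'b) set). g b)
      = (\<Prod>b\<in>(\<lambda>u. (u, 0)) ` Basis. g b) * (\<Prod>b\<in>(\<lambda>v. (0, v)) ` Basis. g b)"
    unfolding Basis_prod_def by (rule prod.union_disjoint) auto
  also have "\<dots> = (\<Prod>u\<in>Basis. g (u, 0)) * (\<Prod>v\<in>Basis. g (0, v))"
    by (simp add: prod.reindex inj_on_def)
  finally show ?thesis .
qed

subsection \<open>The focusing set\<close>

text \<open>Among the basis vectors, \<open>snd b = 0\<close> singles out the space directions; the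
  remaining one is the time direction.\<close>

definition focus_period :: "real \<Rightarrow> 'a::euclidean_space \<times> real \<Rightarrow> real" where
  "focus_period l b = (if snd b = 0 then 2 * pi / l else 2 * pi / l\<^sup>2)"

definition focus_set :: "real \<Rightarrow> real \<Rightarrow> ('a::euclidean_space \<times> real) set" where
  "focus_set l R = slab_grid (focus_period l) ((R - 1) / 2)"

lemma focus_period_gt_1:
  assumes "0 < l" "l \<le> 1"
  shows "1 < focus_period l b"
proof -
  have "l < 2 * pi" "l\<^sup>2 < 2 * pi"
    using assms pi_gt3 power_le_one[of l 2] by auto
  then show ?thesis
    using assms by (simp add: focus_period_def field_simps)
qed

lemma prod_focus_period:
  "(\<Prod>b\<in>(Basis::('a::euclidean_space \<times> real) set). h (focus_period l b))
    = h (2 * pi / l) ^ DIM('a) * h (2 * pi / l\<^sup>2)"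
  by (simp add: prod_Basis_prod focus_period_def)

lemma measure_focus_set_Int_cube_le:
  fixes c :: "'a::euclidean_space \<times> real"
  assumes "0 < l" "l \<le> 1" "0 \<le> \<rho>"
  shows "measure lebesgue (focus_set l R \<inter> cube \<rho> c)
    \<le> 2 ^ (DIM('a) + 1) * ((1 + \<rho> * l) ^ DIM('a) * (1 + \<rho> * l\<^sup>2))"
proof -
  have le: "2 + \<rho> / (2 * pi / x) \<le> 2 * (1 + \<rho> * x)" if "0 < x" for x
  proof -
    have "\<rho> / (2 * pi / x) = \<rho> * x / (2 * pi)"
      by simp
    also have "\<dots> \<le> \<rho> * x"
      using assms that pi_gt3 mult_left_mono[of 1 "2 * pi" "\<rho> * x"] by (simp add: field_simps)
    finally show ?thesis
      using assms that by (smt (verit) mult_nonneg_nonneg)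
  qed
  have "measure lebesgue (focus_set l R \<inter> cube \<rho> c)
      \<le> (\<Prod>b\<in>(Basis::('a \<times> real) set). 2 + \<rho> / focus_period l b)"
    unfolding focus_set_def using focus_period_gt_1[OF assms(1,2)]
    by (intro measure_slab_grid_Int_cube_le assms less_imp_le)
  also have "\<dots> = (2 + \<rho> / (2 * pi / l)) ^ DIM('a) * (2 + \<rho> / (2 * pi / l\<^sup>2))"
    by (rule prod_focus_period)
  also have "\<dots> \<le> (2 * (1 + \<rho> * l)) ^ DIM('a) * (2 * (1 + \<rho> * l\<^sup>2))"
    using assms by (intro mult_mono power_mono le) auto
  also have "\<dots> = 2 ^ (DIM('a) + 1) * ((1 + \<rho> * l) ^ DIM('a) * (1 + \<rho> * l\<^sup>2))"
    unfolding power_mult_distrib by simp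
  finally show ?thesis .
qed

lemma measure_focus_set_ge:
  assumes "0 < l" "l \<le> 1" "2 \<le> R"
  shows "(R * l / (8 * pi)) ^ DIM('a) * (R * l\<^sup>2 / (8 * pi))
    \<le> measure lebesgue (focus_set l R :: ('a::euclidean_space \<times> real) set)"
proof -
  \<comment> \<open>For \<open>R \<ge> 2\<close> one has \<open>(R - 1) / 2 \<ge> R / 4\<close>,
    which turns \<open>2 * pi\<close> into \<open>8 * pi\<close>.\<close>
  have le: "R * x / (8 * pi) \<le> (R - 1) / 2 / (2 * pi / x)" if "0 < x" for x
    using assms that by (simp add: field_simps)
  have "(R * l / (8 * pi)) ^ DIM('a) * (R * l\<^sup>2 / (8 * pi))
      \<le> ((R - 1) / 2 / (2 * pi / l)) ^ DIM('a) * ((R - 1) / 2 / (2 * pi / l\<^sup>2))"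
    using assms by (intro mult_mono power_mono le) auto
  also have "\<dots> = (\<Prod>b\<in>(Basis::('a \<times> real) set). (R - 1) / 2 / focus_period l b)"
    by (rule prod_focus_period[symmetric])
  also have "\<dots> \<le> measure lebesgue (focus_set l R :: ('a \<times> real) set)"
    unfolding focus_set_def using focus_period_gt_1[OF assms(1,2)] assms(3)
    by (intro measure_slab_grid_ge) auto
  finally show ?thesis .
qed

text \<open>The two cases are separated by \<open>\<rho> = 1 / l\<^sup>2\<close>, where the bound \<open>\<rho> powr (n / 2)\<close> is sharp.\<close>

lemma focus_count_le:
  fixes \<rho> l \<alpha> :: real
  assumes "1 \<le> \<rho>" "0 < l" "l \<le> 1" "real n / 2 \<le> \<alpha>"
  shows "(1 + \<rho> * l) ^ n * (1 + \<rho> * l\<^sup>2) \<le> 2 ^ (n + 1) * max (\<rho> powr \<alpha>) (\<rho> ^ (n + 1) * l ^ (n + 2))"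
proof (cases "\<rho> * l\<^sup>2 \<le> 1")
  case True
  have "(\<rho> * l)\<^sup>2 \<le> \<rho>"
    using mult_left_mono[OF True, of \<rho>] assms by (simp add: power2_eq_square mult_ac)
  then have "\<rho> * l \<le> sqrt \<rho>"
    by (rule real_le_rsqrt)
  moreover have "1 \<le> sqrt \<rho>"
    using assms by simp
  ultimately have "1 + \<rho> * l \<le> 2 * sqrt \<rho>"
    by linarith
  then have "(1 + \<rho> * l) ^ n \<le> (2 * sqrt \<rho>) ^ n"
    using assms by (intro power_mono) auto
  then have "(1 + \<rho> * l) ^ n * (1 + \<rho> * l\<^sup>2) \<le> (2 * sqrt \<rho>) ^ n * 2"
    using assms True by (intro mult_mono) auto
  also have "\<dots> = 2 ^ (n + 1) * \<rho> powr (real n / 2)"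
    using assms by (simp add: power_mult_distrib powr_half_sqrt[symmetric] powr_power)
  also have "\<dots> \<le> 2 ^ (n + 1) * max (\<rho> powr \<alpha>) (\<rho> ^ (n + 1) * l ^ (n + 2))"
    using assms powr_mono[of "real n / 2" \<alpha> \<rho>] by (intro mult_left_mono max.coboundedI1) auto
  finally show ?thesis .
next
  case False
  have "\<rho> * l\<^sup>2 \<le> \<rho> * l"
    using assms by (intro mult_left_mono) (auto simp: power2_eq_square mult_left_le)
  then have "1 \<le> \<rho> * l"
    using False by linarith
  then have "(1 + \<rho> * l) ^ n * (1 + \<rho> * l\<^sup>2) \<le> (2 * (\<rho> * l)) ^ n * (2 * (\<rho> * l\<^sup>2))"
    using False by (intro mult_mono power_mono) auto
  also have "\<dots> = 2 ^ (n + 1) * (\<rho> ^ (n + 1) * l ^ (n + 2))"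
    by (simp add: power_mult_distrib power2_eq_square)
  also have "\<dots> \<le> 2 ^ (n + 1) * max (\<rho> powr \<alpha>) (\<rho> ^ (n + 1) * l ^ (n + 2))"
    by (intro mult_left_mono) auto
  finally show ?thesis .
qed

lemma cube_subset_focus_set:
  assumes "1 \<le> R"
  shows "cube 1 0 \<subseteq> focus_set l R"
proof -
  have "0 \<in> {c::'a \<times> real. \<forall>b\<in>Basis. \<exists>k::int. c \<bullet> b = focus_period l b * of_int k \<and> \<bar>c \<bullet> b\<bar> \<le> (R - 1) / 2}"
    using assms by auto
  then show ?thesis
    unfolding focus_set_def slab_grid_eq_Union_cubes by blast
qed

lemma measure_cube_1: "measure lebesgue (cube 1 (c::'a::euclidean_space)) = 1"
proof -
  have "measure lebesgue (cube 1 c) = measure lborel (cbox (c - (1/2) *\<^sub>R One) (c + (1/2) *\<^sub>R One))"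
    unfolding cube_def by (rule measure_completion) simp
  also have "\<dots> = (\<Prod>b\<in>(Basis::'a set). 1)"
    by (subst content_cbox) (auto simp: inner_diff_left inner_add_left intro!: prod.cong)
  finally show ?thesis by simp
qed

text \<open>Dividing the count by \<open>\<rho> powr \<alpha>\<close> turns its second term into
  \<open>\<rho> powr (2 * \<beta>) * R powr (- \<beta>)\<close>, which increases with
  \<open>\<rho>\<close>. At \<open>s = sqrt R\<close> this is exactly 1 and at \<open>s = R\<close>
  it is \<open>R powr \<beta>\<close>: the two density bounds of the theorem.\<close>

lemma focus_set_density_le:
  fixes c :: "'a::euclidean_space \<times> real"
  assumes l: "0 < l" "l \<le> 1" "l ^ (DIM('a) + 2) = R powr (- \<beta>)"
    and \<alpha>: "real DIM('a) / 2 \<le> \<alpha>" "real DIM('a) + 1 - \<alpha> = 2 * \<beta>" "0 \<le> \<beta>"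
    and "1 \<le> \<rho>" "\<rho> \<le> s" "0 < R"
  shows "\<rho> powr (- \<alpha>) * measure lebesgue (focus_set l R \<inter> cube \<rho> c)
    \<le> 4 ^ (DIM('a) + 1) * max 1 (s powr (2 * \<beta>) * R powr (- \<beta>))"
proof -
  let ?n = "DIM('a)"
  have "measure lebesgue (focus_set l R \<inter> cube \<rho> c)
      \<le> 2 ^ (?n + 1) * ((1 + \<rho> * l) ^ ?n * (1 + \<rho> * l\<^sup>2))"
    using assms by (intro measure_focus_set_Int_cube_le) auto
  also have "\<dots> \<le> 2 ^ (?n + 1) * (2 ^ (?n + 1) * max (\<rho> powr \<alpha>) (\<rho> ^ (?n + 1) * l ^ (?n + 2)))"
    using assms by (intro mult_left_mono focus_count_le) auto
  also have "\<dots> = 4 ^ (?n + 1) * max (\<rho> powr \<alpha>) (\<rho> ^ (?n + 1) * l ^ (?n + 2))"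
    by (simp add: mult.assoc[symmetric] power_mult_distrib[symmetric])
  finally have "\<rho> powr (- \<alpha>) * measure lebesgue (focus_set l R \<inter> cube \<rho> c)
      \<le> \<rho> powr (- \<alpha>) * (4 ^ (?n + 1) * max (\<rho> powr \<alpha>) (\<rho> ^ (?n + 1) * l ^ (?n + 2)))"
    by (intro mult_left_mono) auto
  also have "\<dots> = 4 ^ (?n + 1) * (\<rho> powr (- \<alpha>) * max (\<rho> powr \<alpha>) (\<rho> ^ (?n + 1) * l ^ (?n + 2)))"
    by (simp only: mult_ac)
  also have "\<rho> powr (- \<alpha>) * max (\<rho> powr \<alpha>) (\<rho> ^ (?n + 1) * l ^ (?n + 2))
      = max 1 (\<rho> powr (2 * \<beta>) * R powr (- \<beta>))"
  proof -
    have "\<rho> powr (- \<alpha>) * \<rho> powr \<alpha> = 1"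
      using assms by (simp flip: powr_add)
    moreover have "\<rho> powr (- \<alpha>) * \<rho> ^ (?n + 1) = \<rho> powr (2 * \<beta>)"
      using assms by (simp flip: powr_realpow powr_add del: power_Suc add: add.commute)
    ultimately show ?thesis
      using l(3) by (simp add: max_mult_distrib_left mult.assoc[symmetric] del: power_Suc)
  qed
  also have "4 ^ (?n + 1) * max 1 (\<rho> powr (2 * \<beta>) * R powr (- \<beta>)) \<le> 4 ^ (?n + 1) * max 1 (s powr (2 * \<beta>) * R powr (- \<beta>))"
    using assms by (intro mult_left_mono max.mono mult_right_mono powr_mono2) auto
  finally show ?thesis .
qed

text \<open>The product \<open>(R * l)^n * (R * l^2)\<close> is
  \<open>R^(n + 1) * l^(n + 2)\<close>, that is \<open>R powr (n + 1 - \<beta>)\<close>, and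
  \<open>n + 1 - \<beta> = \<alpha> + \<beta>\<close>.\<close>

lemma measure_focus_set_powr_ge:
  assumes l: "0 < l" "l \<le> 1" "l ^ (DIM('a) + 2) = R powr (- \<beta>)"
    and "real DIM('a) + 1 - \<alpha> = 2 * \<beta>" "2 \<le> R"
  shows "R powr (\<alpha> + \<beta>) / (8 * pi) ^ (DIM('a) + 1)
    \<le> measure lebesgue (focus_set l R :: ('a::euclidean_space \<times> real) set)"
proof -
  let ?n = "DIM('a)"
  have "\<alpha> + \<beta> = real (?n + 1) + (- \<beta>)"
    using assms(4) by simp
  then have "R powr (\<alpha> + \<beta>) = R powr real (?n + 1) * R powr (- \<beta>)"
    by (simp only: powr_add)
  also have "\<dots> = R ^ (?n + 1) * l ^ (?n + 2)"
    using assms by (simp only: powr_realpow)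
  also have "\<dots> = (R * l) ^ ?n * (R * l\<^sup>2)"
    by (simp add: power_mult_distrib power2_eq_square)
  finally have "R powr (\<alpha> + \<beta>) / (8 * pi) ^ (?n + 1) = (R * l / (8 * pi)) ^ ?n * (R * l\<^sup>2 / (8 * pi))"
    by (simp add: power_divide)
  then show ?thesis
    using measure_focus_set_ge[where 'a = 'a, of l R] assms by simp
qed

lemma focus_set_props:
  assumes "0 < l" "l \<le> 1"
  shows focus_set_borel: "focus_set l R \<in> sets borel"
    and focus_set_subset_cube: "focus_set l R \<subseteq> cube R 0"
    and focus_set_Union_cubes: "\<exists>centers. focus_set l R = (\<Union>c\<in>centers. cube 1 c)"
proof -
  show "focus_set l R \<in> sets borel"
    unfolding focus_set_def using focus_period_gt_1[OF assms]
    by (intro slab_grid_borel less_trans[OF zero_less_one])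
  show "focus_set l R \<subseteq> cube R 0"
    unfolding focus_set_def by (intro slab_grid_subset_cube) simp
  show "\<exists>centers. focus_set l R = (\<Union>c\<in>centers. cube 1 c)"
    unfolding focus_set_def slab_grid_eq_Union_cubes by blast
qed

text \<open>Suprema of reals are meaningful only for bounded families; the common bound
  \<open>U\<close> controls the inner and the outer one.\<close>

lemma
  fixes Q :: "'a \<Rightarrow> 'b \<Rightarrow> real"
  assumes Q: "\<And>\<rho> c. \<rho> \<in> S \<Longrightarrow> Q \<rho> c \<le> U"
  shows SUP_SUP_le: "S \<noteq> {} \<Longrightarrow> (SUP \<rho>\<in>S. SUP c. Q \<rho> c) \<le> U"
    and le_SUP_SUP: "\<rho> \<in> S \<Longrightarrow> Q \<rho> c \<le> (SUP \<rho>\<in>S. SUP c. Q \<rho> c)"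
    and SUP_le_SUP_SUP: "\<rho> \<in> S \<Longrightarrow> (SUP c. Q \<rho> c) \<le> (SUP \<rho>\<in>S. SUP c. Q \<rho> c)"
proof -
  have inner: "(SUP c. Q \<rho> c) \<le> U" if "\<rho> \<in> S" for \<rho>
    using Q[OF that] by (intro cSUP_least) auto
  show "(SUP \<rho>\<in>S. SUP c. Q \<rho> c) \<le> U" if "S \<noteq> {}"
    by (rule cSUP_least[OF that inner])
  have outer: "(SUP c. Q \<rho> c) \<le> (SUP \<rho>\<in>S. SUP c. Q \<rho> c)" if "\<rho> \<in> S" for \<rho>
    by (rule cSUP_upper[OF that bdd_aboveI2[OF inner]])
  then show "\<rho> \<in> S \<Longrightarrow> (SUP c. Q \<rho> c) \<le> (SUP \<rho>\<in>S. SUP c. Q \<rho> c)" .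
  show "Q \<rho> c \<le> (SUP \<rho>\<in>S. SUP c. Q \<rho> c)" if "\<rho> \<in> S"
    by (rule order_trans[OF cSUP_upper[OF UNIV_I bdd_aboveI2[OF Q[OF that]]] outer[OF that]])
qed

subsection \<open>The focusing estimate\<close>

text \<open>Each coordinate of a point of the set is within 1/2 of a lattice point, with index
  \<open>k\<close> in space and \<open>j\<close> in time, and each frequency in the comb is within
  \<open>d\<close> of some \<open>l * m\<close>. So \<open>schroedinger_phase_close\<close> gives
  the phase condition on the whole set, with the integer \<open>k * m + j * m^2\<close>.\<close>

lemma L2_norm_on_schroedinger_focus_set_ge:
  fixes l R d :: real
  assumes l: "0 < l" "l \<le> 1" and "1 \<le> R"
  defines "M \<equiv> {m::int. \<bar>l * of_int m\<bar> \<le> 1/4}" and "(d::real) \<equiv> 1 / (4 * R)"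
  shows "(card M * d / (8 * pi)) ^ CARD('n) * sqrt (measure lebesgue (focus_set l R :: ((real^'n) \<times> real) set))
    \<le> L2_norm_on (focus_set l R) (schroedinger (comb_wave_hat d l M :: real^'n \<Rightarrow> complex))"
proof (rule L2_norm_on_ge)
  let ?Y = "focus_set l R :: ((real^'n) \<times> real) set"
  have d: "0 < d" using \<open>1 \<le> R\<close> by (simp add: d_def)
  show "?Y \<in> sets borel"
    by (rule focus_set_borel[OF l])
  show "bounded ?Y"
    using focus_set_subset_cube[OF l, of R] by (rule bounded_subset[rotated]) (simp add: cube_def)
  show "schroedinger (comb_wave_hat d l M :: real^'n \<Rightarrow> complex) \<in> borel_measurable borel"
    by (intro schroedinger_borel_measurable) measurable
  show "cmod (schroedinger (comb_wave_hat d l M) z)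
      \<le> 1 / (2 * pi) ^ CARD('n) * (LINT \<xi>|lborel. cmod (comb_wave_hat d l M (\<xi>::real^'n)))" for z :: "(real^'n) \<times> real"
    by (intro cmod_schroedinger_le integrable_comb_wave_hat d)
  show "0 \<le> (card M * d / (8 * pi)) ^ CARD('n)"
    using d by simp
  fix z :: "(real^'n) \<times> real" assume z: "z \<in> ?Y"
  obtain x t where xt: "z = (x, t)" by fastforce
  have "x \<bullet> u \<in> slab_comb (2 * pi / l) ((R - 1) / 2)" if "u \<in> Basis" for u
  proof -
    have "(u, 0) \<in> (Basis :: ((real^'n) \<times> real) set)"
      using that by (simp add: Basis_prod_def)
    then have "(x, t) \<bullet> (u, 0) \<in> slab_comb (focus_period l (u, 0)) ((R - 1) / 2)"
      using z unfolding xt focus_set_def slab_grid_def by blast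
    then show ?thesis by (simp add: focus_period_def)
  qed
  from this[of "axis i 1" for i] have x: "x $ i \<in> slab_comb (2 * pi / l) ((R - 1) / 2)" for i
    by (simp add: axis_in_Basis_iff inner_axis)
  have "(0, 1) \<in> (Basis :: ((real^'n) \<times> real) set)"
    by (simp add: Basis_prod_def)
  then have "(x, t) \<bullet> (0, 1) \<in> slab_comb (focus_period l (0 :: real^'n, 1)) ((R - 1) / 2)"
    using z unfolding xt focus_set_def slab_grid_def by blast
  then have t: "t \<in> slab_comb (2 * pi / l\<^sup>2) ((R - 1) / 2)"
    by (simp add: focus_period_def)
  have slab: "\<exists>k::int. \<bar>y - p * of_int k\<bar> \<le> 1/2 \<and> \<bar>p * of_int k\<bar> \<le> R / 2" if "y \<in> slab_comb p ((R - 1) / 2)" for y p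
  proof -
    obtain k :: int where "\<bar>p * of_int k\<bar> \<le> (R - 1) / 2" "p * of_int k - 1/2 \<le> y" "y \<le> p * of_int k + 1/2"
      using \<open>y \<in> slab_comb p ((R - 1) / 2)\<close> unfolding slab_comb_def by auto
    moreover from this have "\<bar>y - p * of_int k\<bar> \<le> 1/2"
      by linarith
    moreover have "(R - 1) / 2 \<le> R / 2"
      by simp
    ultimately show ?thesis
      by (meson order_trans)
  qed
  show "(card M * d / (8 * pi)) ^ CARD('n) \<le> cmod (schroedinger (comb_wave_hat d l M) z)"
    unfolding xt
  proof (rule cmod_schroedinger_comb_wave_hat_ge[OF d])
    fix i s assume "comb_hat d l M s \<noteq> 0"
    then obtain m where m: "m \<in> M" "\<bar>s - l * of_int m\<bar> < d"
      using comb_hat_neq_0D d by blast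
    obtain k :: int where k: "\<bar>x $ i - 2 * pi / l * of_int k\<bar> \<le> 1/2" "\<bar>2 * pi / l * of_int k\<bar> \<le> R / 2"
      using slab[OF x] by blast
    obtain j :: int where j: "\<bar>t - 2 * pi / l\<^sup>2 * of_int j\<bar> \<le> 1/2" "\<bar>2 * pi / l\<^sup>2 * of_int j\<bar> \<le> R / 2"
      using slab[OF t] by blast
    show "\<exists>k::int. \<bar>x $ i * s + t * s\<^sup>2 - 2 * pi * of_int k\<bar> \<le> 1"
      using schroedinger_phase_close[OF \<open>1 \<le> R\<close> l(1) _ _ k j, of m s] m
      unfolding M_def d_def by (intro exI[of _ "k * m + j * m\<^sup>2"]) auto
  qed
qed

text \<open>Up to constants, the data have norm at most \<open>X powr (n / 2)\<close> and the
  solution has norm at least \<open>X^n\<close> times the root of the measure of the set. The ratio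
  gains from \<open>X \<ge> 1 / (16 * (R * l))\<close> and from the measure being at least of order
  \<open>R powr (\<alpha> + \<beta>)\<close>, which equals \<open>(R * l)^n * G^2\<close>; what
  remains is \<open>G\<close>.\<close>

lemma focusing_estimate:
  fixes l R d \<alpha> \<beta> :: real
  assumes l: "0 < l" "l \<le> 1" "l ^ (CARD('n) + 2) = R powr (- \<beta>)" "l = R powr (- (\<beta> / (real CARD('n) + 2)))"
    and \<beta>: "real CARD('n) + 1 - \<alpha> = 2 * \<beta>" "\<beta> \<le> real CARD('n) + 2" and "2 \<le> R"
  defines "M \<equiv> {m::int. \<bar>l * of_int m\<bar> \<le> 1/4}" and "(d::real) \<equiv> 1 / (4 * R)"
  shows "L2_norm_on UNIV (comb_wave d l M :: real^'n \<Rightarrow> complex) * R powr ((1 + \<alpha>) / (2 * (real CARD('n) + 2)))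
    \<le> sqrt ((512 * pi) ^ CARD('n) * (8 * pi) ^ (CARD('n) + 1))
      * L2_norm_on (focus_set l R) (schroedinger (comb_wave_hat d l M :: real^'n \<Rightarrow> complex))"
proof -
  let ?n = "CARD('n)" and ?Y = "focus_set l R :: ((real^'n) \<times> real) set"
  define X where "X = card M * d"
  \<comment> \<open>There are at least \<open>1 / (4 * l)\<close> frequencies, and each contributes
    \<open>d = 1 / (4 * R)\<close>.\<close>
  have X: "1 / (16 * (R * l)) \<le> X"
  proof -
    have "1 / 4 / l \<le> card M"
      unfolding M_def using l(1) by (intro card_abs_mult_le_int_ge) auto
    then have "1 / 4 / l * d \<le> X"
      unfolding X_def using \<open>2 \<le> R\<close> by (intro mult_right_mono) (auto simp: d_def)
    then show ?thesis
      by (simp add: d_def field_simps)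
  qed
  have Xpos: "0 < X"
    using X l(1) \<open>2 \<le> R\<close> by (smt (verit) divide_pos_pos mult_pos_pos)
  have finM: "finite M"
    unfolding M_def using l(1) by (rule finite_abs_mult_le_int)
  have dl: "d \<le> l"
  proof -
    have "d \<le> R powr (- 1)"
      using \<open>2 \<le> R\<close> by (simp add: d_def powr_minus field_simps)
    also have "\<dots> \<le> l"
      unfolding l(4) using \<beta>(2) \<open>2 \<le> R\<close> by (intro powr_mono) (auto simp: field_simps)
    finally show ?thesis .
  qed
  define G where "G = R powr ((1 + \<alpha>) / (2 * (real ?n + 2)))"
  have key: "(X / (2 * pi)) ^ ?n * G\<^sup>2
      \<le> (512 * pi) ^ ?n * (8 * pi) ^ (?n + 1) * (((X / (8 * pi)) ^ ?n)\<^sup>2 * (R powr (\<alpha> + \<beta>) / (8 * pi) ^ (?n + 1)))"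
  proof -
    have "R powr (\<alpha> + \<beta>) = (R * l) ^ ?n * G\<^sup>2"
    proof -
      have "(R * l) ^ ?n = (R powr (1 - \<beta> / (real ?n + 2))) ^ ?n"
        using \<open>2 \<le> R\<close> by (simp add: l(4) powr_diff powr_minus divide_inverse)
      also have "\<dots> = R powr (real ?n * (1 - \<beta> / (real ?n + 2)))"
        using \<open>2 \<le> R\<close> by (simp add: powr_power mult.commute)
      finally have "(R * l) ^ ?n * G\<^sup>2 = R powr (real ?n * (1 - \<beta> / (real ?n + 2)) + 2 * ((1 + \<alpha>) / (2 * (real ?n + 2))))"
        using \<open>2 \<le> R\<close> by (simp add: G_def powr_power powr_add mult.commute)
      also have "real ?n * (1 - \<beta> / (real ?n + 2)) + 2 * ((1 + \<alpha>) / (2 * (real ?n + 2))) = \<alpha> + \<beta>"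
      proof -
        have \<alpha>: "\<alpha> = real ?n + 1 - 2 * \<beta>" using \<beta>(1) by simp
        have "real ?n * (1 - \<beta> / (real ?n + 2)) + 2 * ((1 + \<alpha>) / (2 * (real ?n + 2)))
            = (real ?n * (real ?n + 2 - \<beta>) + (1 + \<alpha>)) / (real ?n + 2)"
        proof -
          have "2 * ((1 + \<alpha>) / (2 * q)) = (1 + \<alpha>) / q" for q :: real
            by (simp add: divide_simps)
          moreover have "real ?n * (1 - \<beta> / (real ?n + 2)) = real ?n * (real ?n + 2 - \<beta>) / (real ?n + 2)"
            by (simp add: divide_simps)
          ultimately show ?thesis
            by (simp only: add_divide_distrib)
        qed
        \<comment> \<open>After \<open>\<alpha> = n + 1 - 2 * \<beta>\<close> is inserted, both
          sides are \<open>(n + 2) * (n + 1 - \<beta>)\<close>.\<close>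
        also have "real ?n * (real ?n + 2 - \<beta>) + (1 + \<alpha>) = (\<alpha> + \<beta>) * (real ?n + 2)"
          unfolding \<alpha> by (simp add: algebra_simps)
        finally show ?thesis
          by simp
      qed
      finally show ?thesis by simp
    qed
    then have "(512 * pi) ^ ?n * (8 * pi) ^ (?n + 1) * (((X / (8 * pi)) ^ ?n)\<^sup>2 * (R powr (\<alpha> + \<beta>) / (8 * pi) ^ (?n + 1)))
        = (512 * pi) ^ ?n * ((X / (8 * pi)) ^ ?n)\<^sup>2 * ((R * l) ^ ?n * G\<^sup>2)"
      by simp
    also have "\<dots> = (512 * pi * (X / (8 * pi))\<^sup>2 * (R * l)) ^ ?n * G\<^sup>2"
      by (simp only: power_mult_distrib power_mult[symmetric] mult.commute[of 2] mult_ac)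
    also have "\<dots> \<ge> (X / (2 * pi)) ^ ?n * G\<^sup>2"
    proof (intro mult_right_mono power_mono)
      \<comment> \<open>The lower bound on \<open>X\<close> trades one factor \<open>X\<close> for
        \<open>R * l\<close>; the constant is
        \<open>512 * pi = 16 * (8 * pi)^2 / (2 * pi)\<close>.\<close>
      have "1 \<le> 16 * (R * l) * X"
        using X l(1) \<open>2 \<le> R\<close> by (simp add: field_simps)
      then have "X / (2 * pi) * 1 \<le> X / (2 * pi) * (16 * (R * l) * X)"
        using Xpos by (intro mult_left_mono) auto
      also have "\<dots> = 512 * pi * (X / (8 * pi))\<^sup>2 * (R * l)"
        by (simp add: power2_eq_square field_simps)
      finally show "X / (2 * pi) \<le> 512 * pi * (X / (8 * pi))\<^sup>2 * (R * l)" by simp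
    qed (use Xpos in auto)
    finally show ?thesis .
  qed
  have "L2_norm_on UNIV (comb_wave d l M :: real^'n \<Rightarrow> complex) \<le> sqrt ((X / (2 * pi)) ^ ?n)"
    using L2_norm_on_comb_wave_le[OF _ dl finM, where 'a = "real^'n"] \<open>2 \<le> R\<close> by (simp add: X_def d_def mult.commute)
  then have "L2_norm_on UNIV (comb_wave d l M :: real^'n \<Rightarrow> complex) * G \<le> sqrt ((X / (2 * pi)) ^ ?n) * G"
    by (intro mult_right_mono) (auto simp: G_def)
  also have "\<dots> = sqrt ((X / (2 * pi)) ^ ?n * G\<^sup>2)"
    by (simp add: real_sqrt_mult G_def)
  also have "\<dots> \<le> sqrt ((512 * pi) ^ ?n * (8 * pi) ^ (?n + 1) * (((X / (8 * pi)) ^ ?n)\<^sup>2 * (R powr (\<alpha> + \<beta>) / (8 * pi) ^ (?n + 1))))"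
    using key by (rule real_sqrt_le_mono)
  also have "\<dots> = sqrt ((512 * pi) ^ ?n * (8 * pi) ^ (?n + 1)) * ((X / (8 * pi)) ^ ?n * sqrt (R powr (\<alpha> + \<beta>) / (8 * pi) ^ (?n + 1)))"
    using Xpos by (simp only: real_sqrt_mult real_sqrt_abs) simp
  also have "\<dots> \<le> sqrt ((512 * pi) ^ ?n * (8 * pi) ^ (?n + 1)) * ((X / (8 * pi)) ^ ?n * sqrt (measure lebesgue ?Y))"
    using measure_focus_set_powr_ge[where 'a = "real^'n", of l R \<beta> \<alpha>] assms Xpos
    by (intro mult_left_mono real_sqrt_le_mono) auto
  also have "\<dots> \<le> sqrt ((512 * pi) ^ ?n * (8 * pi) ^ (?n + 1))
      * L2_norm_on ?Y (schroedinger (comb_wave_hat d l M :: real^'n \<Rightarrow> complex))"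
    using L2_norm_on_schroedinger_focus_set_ge[where 'n = 'n, OF l(1,2), of R] \<open>2 \<le> R\<close>
    by (intro mult_left_mono) (auto simp: X_def M_def d_def)
  finally show ?thesis
    unfolding G_def .
qed

section \<open>Choice of parameters, density estimates and the final inequality\<close>

theorem proposition1p6:
  fixes \<alpha> :: real
  assumes "real CARD('n::finite) / 2 \<le> \<alpha>"
    and "\<alpha> < real CARD('n) + 1"
  shows "\<exists>R0\<ge>1. \<exists>(f :: real \<Rightarrow> real ^ 'n \<Rightarrow> complex) (fhat :: real \<Rightarrow> real ^ 'n \<Rightarrow> complex)
            (Y :: real \<Rightarrow> ((real ^ 'n) \<times> real) set).
      (\<forall>R\<ge>R0.
          square_integrable (f R) \<and>
          \<not> (AE x in lebesgue. f R x = 0) \<and>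
          has_fourier_transform (f R) (fhat R) \<and>
          (AE \<xi> in lebesgue. \<xi> \<notin> cube 1 0 \<longrightarrow> fhat R \<xi> = 0) \<and>
          (\<exists>centers. Y R = (\<Union>c\<in>centers. cube 1 c)) \<and>
          Y R \<subseteq> cube R 0 \<and>
          gamma_bar \<alpha> R (Y R) = gamma_sup \<alpha> R (Y R)) \<and>
      sim_from R0 (\<lambda>R. gamma_sup \<alpha> (sqrt R) (Y R)) (\<lambda>R. 1) \<and>
      sim_from R0 (\<lambda>R. gamma_sup \<alpha> R (Y R)) (\<lambda>R. R powr ((real CARD('n) + 1 - \<alpha>) / 2)) \<and>
      gtrapprox_from R0
        (\<lambda>R. L2_norm_on (Y R) (schroedinger (fhat R)))
        (\<lambda>R. (gamma_sup \<alpha> (sqrt R) (Y R) * gamma_bar \<alpha> R (Y R) * R powr \<alpha> *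
               (SUP c. measure lebesgue (Y R \<inter> cube (sqrt R) c) ^ CARD('n)))
             powr (1 / ((real CARD('n) + 1) * (real CARD('n) + 2))) *
             L2_norm_on UNIV (f R))"
proof -
  let ?n = "CARD('n)"
  define \<beta> where "\<beta> = (real ?n + 1 - \<alpha>) / 2"
  define C where "C = (4::real) ^ (?n + 1)"
  define c where "c = 1 / (8 * pi) ^ (?n + 1)"
  \<comment> \<open>\<open>C\<close> bounds the density at scales up to \<open>sqrt R\<close>, and
    \<open>c * R powr \<beta>\<close> bounds it from below at scale \<open>R\<close>. From
    \<open>R0\<close> on the second dominates the first, which makes the two suprema over scales
    agree.\<close>
  define R0 where "R0 = max 2 ((C / c) powr (1 / \<beta>))"
  define l where "l = (\<lambda>R. R powr (- (\<beta> / (real ?n + 2))))"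
  define d where "d = (\<lambda>R::real. 1 / (4 * R))"
  define M where "M = (\<lambda>R. {m::int. \<bar>l R * of_int m\<bar> \<le> 1/4})"
  define f where "f = (\<lambda>R. comb_wave (d R) (l R) (M R) :: real^'n \<Rightarrow> complex)"
  define fhat where "fhat = (\<lambda>R. comb_wave_hat (d R) (l R) (M R) :: real^'n \<Rightarrow> complex)"
  define Y where "Y = (\<lambda>R. focus_set (l R) R :: ((real^'n) \<times> real) set)"
  define Q where "Q = (\<lambda>R \<rho> z. \<rho> powr (- \<alpha>) * measure lebesgue (Y R \<inter> cube \<rho> z))"
  have \<beta>: "0 < \<beta>" "real ?n + 1 - \<alpha> = 2 * \<beta>" "\<beta> \<le> real ?n + 2"
    using assms by (auto simp: \<beta>_def field_simps)
  have C: "1 \<le> C" and c: "0 < c"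
    using one_le_power[of "4::real" "?n + 1"] by (simp_all add: C_def c_def)
  have sup_eq: "gamma_sup \<alpha> s (Y R) = (SUP \<rho>\<in>{1..s}. SUP z. Q R \<rho> z)"
    "gamma_bar \<alpha> R (Y R) = (SUP \<rho>\<in>{sqrt R..R}. SUP z. Q R \<rho> z)" for s R
    by (simp_all add: gamma_sup_def gamma_bar_def Q_def)
  have main:
    "0 < l R \<and> l R \<le> 1 \<and> l R ^ (?n + 2) = R powr (- \<beta>) \<and> 1 \<le> sqrt R \<and> sqrt R \<le> R \<and>
      0 < d R \<and> d R \<le> l R \<and> finite (M R)" if "2 \<le> R" for R
  proof (intro conjI)
    show l: "0 < l R" using that by (simp add: l_def)
    show "l R \<le> 1"
      using that \<beta> powr_mono[of "- (\<beta> / (real ?n + 2))" 0 R] by (simp add: l_def)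
    have "l R ^ (?n + 2) = R powr (real (?n + 2) * - (\<beta> / (real ?n + 2)))"
      unfolding l_def using that by (intro powr_power) auto
    then show "l R ^ (?n + 2) = R powr (- \<beta>)"
      by (simp add: add.commute)
    show sqrt: "1 \<le> sqrt R" using that by simp
    show "sqrt R \<le> R"
      using that mult_left_mono[OF sqrt, of "sqrt R"] by simp
    show "0 < d R" using that by (simp add: d_def)
    have "d R \<le> R powr (- 1)"
      using that by (simp add: d_def powr_minus field_simps)
    also have "\<dots> \<le> l R"
      unfolding l_def using \<beta>(3) that by (intro powr_mono) (auto simp: field_simps)
    finally show "d R \<le> l R" .
    show "finite (M R)"
      unfolding M_def using l by (rule finite_abs_mult_le_int)
  qed
  have small: "Q R \<rho> z \<le> C" if "2 \<le> R" "1 \<le> \<rho>" "\<rho> \<le> sqrt R" for R \<rho> z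
  proof -
    have "sqrt R powr (2 * \<beta>) * R powr (- \<beta>) = 1"
      using that by (simp add: powr_half_sqrt[symmetric] powr_powr flip: powr_add)
    then show ?thesis
      using focus_set_density_le[where 'a = "real^'n", of "l R" R \<beta> \<alpha> \<rho> "sqrt R" z] main[OF that(1)] \<beta> assms that
      by (simp add: Q_def Y_def C_def)
  qed
  have large: "Q R \<rho> z \<le> C * R powr \<beta>" if "2 \<le> R" "1 \<le> \<rho>" "\<rho> \<le> R" for R \<rho> z
  proof -
    have "R powr (2 * \<beta>) * R powr (- \<beta>) = R powr \<beta>" "1 \<le> R powr \<beta>"
      using that \<beta> by (simp_all add: ge_one_powr_ge_zero flip: powr_add)
    then show ?thesis
      using focus_set_density_le[where 'a = "real^'n", of "l R" R \<beta> \<alpha> \<rho> R z] main[OF that(1)] \<beta> assms that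
      by (simp add: Q_def Y_def C_def)
  qed
  \<comment> \<open>The unit cube at the origin alone gives the lower bound for the density at small
    scales.\<close>
  have unit: "Q R 1 0 = 1" if "2 \<le> R" for R
  proof -
    have "Y R \<inter> cube 1 0 = cube 1 0"
      using cube_subset_focus_set[of R "l R"] that by (auto simp: Y_def)
    then show ?thesis by (simp add: Q_def measure_cube_1)
  qed
  \<comment> \<open>At scale \<open>R\<close> the cube around the origin catches all of
    \<open>Y R\<close>, so its total measure gives the lower bound.\<close>
  have top: "c * R powr \<beta> \<le> Q R R 0" if "2 \<le> R" for R
  proof -
    have "Y R \<inter> cube R 0 = Y R"
      using focus_set_subset_cube[of "l R" R] main[OF that] by (auto simp: Y_def)
    moreover have "c * R powr (\<alpha> + \<beta>) \<le> measure lebesgue (Y R)"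
      using measure_focus_set_powr_ge[where 'a = "real^'n", of "l R" R \<beta> \<alpha>] main[OF that] \<beta> that
      by (simp add: Y_def c_def)
    ultimately have "R powr (- \<alpha>) * (c * R powr (\<alpha> + \<beta>)) \<le> Q R R 0"
      unfolding Q_def by (simp add: mult_left_mono)
    moreover have "R powr (- \<alpha>) * (c * R powr (\<alpha> + \<beta>)) = c * (R powr (- \<alpha>) * R powr (\<alpha> + \<beta>))"
      by simp
    moreover have "R powr (- \<alpha>) * R powr (\<alpha> + \<beta>) = R powr \<beta>"
      by (simp flip: powr_add)
    ultimately show ?thesis by simp
  qed
  have R0: "2 \<le> R \<and> C \<le> c * R powr \<beta>" if "R0 \<le> R" for R
  proof
    show "2 \<le> R" using that by (simp add: R0_def)
    have "C / c = ((C / c) powr (1 / \<beta>)) powr \<beta>"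
      using \<beta> C c by (simp add: powr_powr)
    also have "\<dots> \<le> R powr \<beta>"
      using that \<beta> by (intro powr_mono2) (auto simp: R0_def)
    finally show "C \<le> c * R powr \<beta>"
      using c by (simp add: field_simps)
  qed
  have gamma_small: "1 \<le> gamma_sup \<alpha> (sqrt R) (Y R)" "gamma_sup \<alpha> (sqrt R) (Y R) \<le> C" if "2 \<le> R" for R
  proof -
    have "Q R 1 0 \<le> gamma_sup \<alpha> (sqrt R) (Y R)"
      unfolding sup_eq using small[OF that] main[OF that] by (intro le_SUP_SUP[where U = C]) auto
    then show "1 \<le> gamma_sup \<alpha> (sqrt R) (Y R)"
      using unit[OF that] by simp
    show "gamma_sup \<alpha> (sqrt R) (Y R) \<le> C"
      unfolding sup_eq using small[OF that] main[OF that] by (intro SUP_SUP_le) auto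
  qed
  have gamma_large: "c * R powr \<beta> \<le> gamma_sup \<alpha> R (Y R)" "gamma_sup \<alpha> R (Y R) \<le> C * R powr \<beta>" if "2 \<le> R" for R
  proof -
    have "Q R R 0 \<le> gamma_sup \<alpha> R (Y R)"
      unfolding sup_eq using large[OF that] that by (intro le_SUP_SUP[where U = "C * R powr \<beta>"]) auto
    then show "c * R powr \<beta> \<le> gamma_sup \<alpha> R (Y R)"
      using top[OF that] by simp
    show "gamma_sup \<alpha> R (Y R) \<le> C * R powr \<beta>"
      unfolding sup_eq using large[OF that] that by (intro SUP_SUP_le) auto
  qed
  have gamma_eq: "gamma_bar \<alpha> R (Y R) = gamma_sup \<alpha> R (Y R)" if "R0 \<le> R" for R
  proof (rule antisym)
    have R: "2 \<le> R" "C \<le> c * R powr \<beta>" "1 \<le> sqrt R" "sqrt R \<le> R"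
      using R0[OF that] main[of R] by auto
    have ge_1: "1 \<le> \<rho>" if "sqrt R \<le> \<rho>" for \<rho>
      by (rule order_trans[OF R(3) that])
    show "gamma_bar \<alpha> R (Y R) \<le> gamma_sup \<alpha> R (Y R)"
      unfolding sup_eq
    proof (rule cSUP_least)
      show "{sqrt R..R} \<noteq> {}" using R by auto
      show "(SUP z. Q R \<rho> z) \<le> (SUP \<rho>\<in>{1..R}. SUP z. Q R \<rho> z)" if "\<rho> \<in> {sqrt R..R}" for \<rho>
        using large[OF R(1)] R that ge_1 by (intro SUP_le_SUP_SUP[where U = "C * R powr \<beta>"]) auto
    qed
    have bar: "(SUP z. Q R \<rho> z) \<le> gamma_bar \<alpha> R (Y R)" "Q R \<rho> z \<le> gamma_bar \<alpha> R (Y R)"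
      if "sqrt R \<le> \<rho>" "\<rho> \<le> R" for \<rho> z
      unfolding sup_eq using large[OF R(1)] R that ge_1
      by (intro SUP_le_SUP_SUP[where U = "C * R powr \<beta>"] le_SUP_SUP[where U = "C * R powr \<beta>"]; auto)+
    show "gamma_sup \<alpha> R (Y R) \<le> gamma_bar \<alpha> R (Y R)"
      unfolding sup_eq(1)
    proof (rule cSUP_least)
      show "{1..R} \<noteq> {}" using R by auto
      fix \<rho> assume \<rho>: "\<rho> \<in> {1..R}"
      show "(SUP z. Q R \<rho> z) \<le> gamma_bar \<alpha> R (Y R)"
      proof (cases "sqrt R \<le> \<rho>")
        \<comment> \<open>Scales below \<open>sqrt R\<close> contribute at most \<open>C\<close>,
          which by the choice of \<open>R0\<close> does not exceed the density of the whole
          cube.\<close>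
        case False
        then have "(SUP z. Q R \<rho> z) \<le> C"
          using \<rho> small[OF R(1)] by (intro cSUP_least) auto
        also have "C \<le> Q R R 0"
          using R(2) top[OF R(1)] by simp
        also have "\<dots> \<le> gamma_bar \<alpha> R (Y R)"
          using R by (intro bar) auto
        finally show ?thesis .
      qed (use \<rho> bar in auto)
    qed
  qed
  show ?thesis
  proof (rule exI[of _ R0], rule conjI, simp add: R0_def,
      rule exI[of _ f], rule exI[of _ fhat], rule exI[of _ Y], intro conjI allI impI)
    fix R assume "R0 \<le> R"
    then have R: "2 \<le> R" using R0 by blast
    note main = main[OF R]
    show "square_integrable (f R)"
      unfolding f_def using main by (intro square_integrable_comb_wave) auto
    show "\<not> (AE x in lebesgue. f R x = 0)"
      unfolding f_def using main by (intro comb_wave_not_AE_0) (auto simp: M_def)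
    show "has_fourier_transform (f R) (fhat R)"
      unfolding f_def fhat_def using main by (intro has_fourier_transform_comb_wave) auto
    \<comment> \<open>Centres up to 1/4 and tents of half-width at most 1/4 keep the support within
      1/2 of the origin in each coordinate.\<close>
    have "d R \<le> 1/4" using R by (simp add: d_def field_simps)
    then show "AE \<xi> in lebesgue. \<xi> \<notin> cube 1 0 \<longrightarrow> fhat R \<xi> = 0"
      unfolding fhat_def using main
      by (intro AE_I2 impI comb_wave_hat_eq_0) (auto simp: M_def)
    show "\<exists>centers. Y R = (\<Union>c\<in>centers. cube 1 c)" "Y R \<subseteq> cube R 0"
      unfolding Y_def using main by (auto intro!: focus_set_Union_cubes focus_set_subset_cube[THEN subsetD])
    show "gamma_bar \<alpha> R (Y R) = gamma_sup \<alpha> R (Y R)"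
      by (rule gamma_eq) fact
  next
    show "sim_from R0 (\<lambda>R. gamma_sup \<alpha> (sqrt R) (Y R)) (\<lambda>R. 1)"
      unfolding sim_from_def
    proof (intro exI[of _ C] conjI allI impI)
      show "0 < C" using C by simp
      fix R assume "R0 \<le> R"
      then have R: "2 \<le> R" using R0 by blast
      have "inverse C \<le> 1" using C by (simp add: inverse_le_1_iff)
      then show "inverse C * 1 \<le> gamma_sup \<alpha> (sqrt R) (Y R)"
        using gamma_small[OF R] by simp
      show "gamma_sup \<alpha> (sqrt R) (Y R) \<le> C * 1"
        using gamma_small[OF R] by simp
    qed
  next
    show "sim_from R0 (\<lambda>R. gamma_sup \<alpha> R (Y R)) (\<lambda>R. R powr ((real ?n + 1 - \<alpha>) / 2))"
      unfolding sim_from_def \<beta>_def[symmetric]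
    proof (intro exI[of _ "max C (1 / c)"] conjI allI impI)
      show "0 < max C (1 / c)" using C by simp
      fix R assume "R0 \<le> R"
      then have R: "2 \<le> R" using R0 by blast
      have "inverse (max C (1 / c)) \<le> inverse (1 / c)"
        using c by (intro le_imp_inverse_le) auto
      then have "inverse (max C (1 / c)) * R powr \<beta> \<le> c * R powr \<beta>"
        by (intro mult_right_mono) auto
      then show "inverse (max C (1 / c)) * R powr \<beta> \<le> gamma_sup \<alpha> R (Y R)"
        using gamma_large[OF R] by simp
      have "C * R powr \<beta> \<le> max C (1 / c) * R powr \<beta>"
        by (intro mult_right_mono) auto
      then show "gamma_sup \<alpha> R (Y R) \<le> max C (1 / c) * R powr \<beta>"
        using gamma_large[OF R] by simp
    qed
  next
    define K where "K = sqrt ((512 * pi) ^ ?n * (8 * pi) ^ (?n + 1))"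
    define e where "e = 1 / ((real ?n + 1) * (real ?n + 2))"
    have K: "0 < K" by (simp add: K_def)
    have e: "0 < e" by (simp add: e_def)
    show "gtrapprox_from R0
        (\<lambda>R. L2_norm_on (Y R) (schroedinger (fhat R)))
        (\<lambda>R. (gamma_sup \<alpha> (sqrt R) (Y R) * gamma_bar \<alpha> R (Y R) * R powr \<alpha> *
               (SUP z. measure lebesgue (Y R \<inter> cube (sqrt R) z) ^ ?n))
             powr (1 / ((real ?n + 1) * (real ?n + 2))) *
             L2_norm_on UNIV (f R))"
      unfolding gtrapprox_from_def
    \<comment> \<open>The constant is the same for every \<open>\<epsilon>\<close>. The power
      \<open>n + 2\<close> counts one \<open>C\<close> for each of the two densities and
      \<open>n\<close> for the power of the local measure; \<open>K\<close> comes from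
      \<open>focusing_estimate\<close>.\<close>
    proof (intro allI impI exI[of _ "(C ^ (?n + 2)) powr e * K"] conjI)
      show "0 < (C ^ (?n + 2)) powr e * K" using C K by simp
      fix \<epsilon> R :: real assume "0 < \<epsilon>" "R0 \<le> R"
      then have R: "2 \<le> R" using R0 by blast
      let ?S = "SUP z. measure lebesgue (Y R \<inter> cube (sqrt R) z) ^ ?n"
      let ?G = "gamma_sup \<alpha> (sqrt R) (Y R) * gamma_bar \<alpha> R (Y R) * R powr \<alpha> * ?S"
      let ?N = "L2_norm_on (Y R) (schroedinger (fhat R))"
      \<comment> \<open>This is the small-scale density bound read at
        \<open>\<rho> = sqrt R\<close>.\<close>
      have meas_le: "measure lebesgue (Y R \<inter> cube (sqrt R) z) ^ ?n \<le> (C * R powr (\<alpha> / 2)) ^ ?n" for z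
      proof (rule power_mono)
        have "sqrt R powr \<alpha> * Q R (sqrt R) z \<le> sqrt R powr \<alpha> * C"
          using small[OF R, of "sqrt R" z] main[OF R] by (intro mult_left_mono) auto
        moreover have "sqrt R powr \<alpha> * Q R (sqrt R) z = measure lebesgue (Y R \<inter> cube (sqrt R) z)"
          using R by (simp add: Q_def mult.assoc[symmetric] flip: powr_add)
        moreover have "sqrt R powr \<alpha> = R powr (\<alpha> / 2)"
          using R by (simp add: powr_half_sqrt[symmetric] powr_powr)
        ultimately show "measure lebesgue (Y R \<inter> cube (sqrt R) z) \<le> C * R powr (\<alpha> / 2)"
          by (simp add: mult.commute)
      qed simp
      have S: "0 \<le> ?S" "?S \<le> (C * R powr (\<alpha> / 2)) ^ ?n"
      proof -
        have "0 \<le> measure lebesgue (Y R \<inter> cube (sqrt R) 0) ^ ?n" by simp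
        also have "\<dots> \<le> ?S"
          by (rule cSUP_upper[OF UNIV_I bdd_aboveI2[OF meas_le]])
        finally show "0 \<le> ?S" .
        show "?S \<le> (C * R powr (\<alpha> / 2)) ^ ?n"
          by (rule cSUP_least[OF UNIV_not_empty meas_le])
      qed
      have G0: "0 \<le> gamma_sup \<alpha> (sqrt R) (Y R)" "0 \<le> gamma_bar \<alpha> R (Y R)"
        using gamma_small[OF R] gamma_large[OF R] gamma_eq[OF \<open>R0 \<le> R\<close>] c
        by (smt (verit) mult_nonneg_nonneg powr_ge_zero)+
      have "?G \<le> C * (C * R powr \<beta>) * R powr \<alpha> * (C * R powr (\<alpha> / 2)) ^ ?n"
        using gamma_small[OF R] gamma_large[OF R] gamma_eq[OF \<open>R0 \<le> R\<close>] S G0 C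
        by (intro mult_mono mult_nonneg_nonneg) auto
      also have "\<dots> = C ^ (?n + 2) * (R powr \<beta> * R powr \<alpha> * R powr (real ?n * (\<alpha> / 2)))"
        using R by (simp add: power_mult_distrib powr_power power2_eq_square)
      also have "R powr \<beta> * R powr \<alpha> * R powr (real ?n * (\<alpha> / 2)) = R powr ((1 + \<alpha>) * (real ?n + 1) / 2)"
      proof -
        have "\<beta> + \<alpha> + real ?n * (\<alpha> / 2) = (1 + \<alpha>) * (real ?n + 1) / 2"
          by (simp add: \<beta>_def field_simps)
        then show ?thesis
          by (simp only: powr_add[symmetric])
      qed
      finally have "?G powr e \<le> (C ^ (?n + 2) * R powr ((1 + \<alpha>) * (real ?n + 1) / 2)) powr e"
        using G0 S e by (intro powr_mono2) auto
      also have "\<dots> = (C ^ (?n + 2)) powr e * R powr ((1 + \<alpha>) * (real ?n + 1) / 2 * e)"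
        using C by (simp add: powr_mult powr_powr)
      \<comment> \<open>The exponent \<open>e\<close> cancels the factor \<open>n + 1\<close> and
        leaves exactly the power of \<open>R\<close> gained in
        \<open>focusing_estimate\<close>.\<close>
      also have "(1 + \<alpha>) * (real ?n + 1) / 2 * e = (1 + \<alpha>) / (2 * (real ?n + 2))"
        unfolding e_def by (simp add: divide_simps)
      finally have G: "?G powr e \<le> (C ^ (?n + 2)) powr e * R powr ((1 + \<alpha>) / (2 * (real ?n + 2)))" .
      have norm0: "0 \<le> L2_norm_on UNIV (f R)" "0 \<le> ?N"
        by (simp_all add: L2_norm_on_def set_lebesgue_integral_def)
      have focus: "L2_norm_on UNIV (f R) * R powr ((1 + \<alpha>) / (2 * (real ?n + 2))) \<le> K * ?N"
        unfolding K_def f_def fhat_def Y_def M_def d_def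
        using main[OF R] \<beta> R by (intro focusing_estimate) (auto simp: l_def)
      have "?G powr e * L2_norm_on UNIV (f R)
          \<le> (C ^ (?n + 2)) powr e * R powr ((1 + \<alpha>) / (2 * (real ?n + 2))) * L2_norm_on UNIV (f R)"
        by (intro mult_right_mono G norm0)
      also have "\<dots> = (C ^ (?n + 2)) powr e * (L2_norm_on UNIV (f R) * R powr ((1 + \<alpha>) / (2 * (real ?n + 2))))"
        by (simp only: mult_ac)
      also have "\<dots> \<le> (C ^ (?n + 2)) powr e * (K * ?N)"
        by (intro mult_left_mono focus) auto
      \<comment> \<open>The estimate already holds without a loss;
        \<open>R powr \<epsilon> \<ge> 1\<close> only weakens it to the required form.\<close>
      also have "\<dots> \<le> R powr \<epsilon> * ((C ^ (?n + 2)) powr e * (K * ?N))"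
        using R \<open>0 < \<epsilon>\<close> K norm0 mult_right_mono[of 1 "R powr \<epsilon>" "(C ^ (?n + 2)) powr e * (K * ?N)"]
        by (simp add: ge_one_powr_ge_zero)
      finally show "?G powr (1 / ((real ?n + 1) * (real ?n + 2))) * L2_norm_on UNIV (f R)
          \<le> (C ^ (?n + 2)) powr e * K * R powr \<epsilon> * ?N"
        by (simp add: e_def mult_ac)
    qed
  qed
qed

end
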